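(* Let $M\subset\mathbb{R}^{n+1}$ be a cone over a connected open set $C\subset\mathbb{S}^n$ with smooth boundary. Any isoperimetric region $\Omega$ in $M$ is bounded.
   Context: The cone over $C$ is $M=\{tp:t>0,\ p\in C\}$. $\mathrm{vol}$ is $(n+1)$-dimensional Hausdorff measure. For measurable $\Omega\subseteq M$, $\mathcal{P}(\Omega)$ is the perimeter relative to $M$: $\mathcal{P}(\Omega)=\sup\{\int_\Omega\mathrm{div}\,Y\,d\mathcal{H}^{n+1}:|Y|\le1\}$ over smooth vector fields $Y$ with compact support in $M$. An isoperimetric region of volume $V\in(0,\infty)$ is a set $\Omega\subseteq M$ with $\mathrm{vol}(\Omega)=V$ and $\mathcal{P}(\Omega)=\inf\{\mathcal{P}(E):E\subseteq M,\ \mathrm{vol}(E)=V\}$. Since perimeter is unchanged by adding or removing sets of $\mathcal{H}^{n+1}$-measure $0$, it is always assumed that $\Omega$ has been normalized so that $0<\mathrm{vol}(\Omega\cap B_r(p))<\mathrm{vol}(B_r(p))$ for every ball $B_r(p)$ centered at $p\in\partial\Omega$ (balls being understood in $M$). *)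

theory Defs
  imports "HOL-Analysis.Analysis"
begin

section \<open>Hausdorff measure\<close>

text \<open>
  The weight of a covering set is normalised by the volume of the unit ball. The empty set is
  treated separately because \<open>0 ^ 0 = 1\<close>, and boundedness is required because
  \<^const>\<open>diameter\<close> is meaningless on unbounded sets.
\<close>

definition hausdorff_weight :: "nat \<Rightarrow> 'a::metric_space set \<Rightarrow> ennreal" where
  "hausdorff_weight k E =
     (if E = {} then 0 else ennreal (unit_ball_vol (real k) * (diameter E / 2) ^ k))"

definition hausdorff_covers :: "real \<Rightarrow> 'a::metric_space set \<Rightarrow> (nat \<Rightarrow> 'a set) set" where
  "hausdorff_covers \<delta> A =
     {E. A \<subseteq> (\<Union>i. E i) \<and> (\<forall>i. bounded (E i) \<and> diameter (E i) \<le> \<delta>)}"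

definition hausdorff_content :: "nat \<Rightarrow> real \<Rightarrow> 'a::metric_space set \<Rightarrow> ennreal" where
  "hausdorff_content k \<delta> A = (INF E\<in>hausdorff_covers \<delta> A. \<Sum>i. hausdorff_weight k (E i))"

definition hausdorff_outer :: "nat \<Rightarrow> 'a::metric_space set \<Rightarrow> ennreal" where
  "hausdorff_outer k A = (SUP \<delta>\<in>{0<..}. hausdorff_content k \<delta> A)"

text \<open>The measurable sets are those that are measurable in the sense of Caratheodory.\<close>

definition hausdorff_measure :: "nat \<Rightarrow> 'a::metric_space measure" where
  "hausdorff_measure k =
     measure_of UNIV (lambda_system UNIV UNIV (hausdorff_outer k)) (hausdorff_outer k)"

lemma hausdorff_content_mono: "A \<subseteq> B \<Longrightarrow> hausdorff_content k \<delta> A \<le> hausdorff_content k \<delta> B"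
  unfolding hausdorff_content_def by (rule INF_superset_mono) (auto simp: hausdorff_covers_def)

lemma hausdorff_content_empty:
  assumes "\<delta> > 0"
  shows "hausdorff_content k \<delta> {} = 0"
proof -
  have "(\<lambda>_. {}) \<in> hausdorff_covers \<delta> ({} :: 'a set)"
    using assms by (simp add: hausdorff_covers_def)
  then have "hausdorff_content k \<delta> ({} :: 'a set) \<le> (\<Sum>i::nat. hausdorff_weight k ({} :: 'a set))"
    unfolding hausdorff_content_def by (rule INF_lower)
  then show ?thesis by (simp add: hausdorff_weight_def)
qed

lemma hausdorff_content_UN:
  fixes A :: "nat \<Rightarrow> 'a::metric_space set"
  shows "hausdorff_content k \<delta> (\<Union>n. A n) \<le> (\<Sum>n. hausdorff_content k \<delta> (A n))"
proof (rule ennreal_le_epsilon)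
  fix e :: real
  assume fin: "(\<Sum>n. hausdorff_content k \<delta> (A n)) < top" and "0 < e"
  let ?w = "\<lambda>E. \<Sum>i. hausdorff_weight k (E i)"
  have "\<exists>E\<in>hausdorff_covers \<delta> (A n). ?w E \<le> hausdorff_content k \<delta> (A n) + ennreal (e * (1/2) ^ Suc n)"
    for n
  proof -
    have "hausdorff_content k \<delta> (A n) < hausdorff_content k \<delta> (A n) + ennreal (e * (1/2) ^ Suc n)"
      using fin \<open>0 < e\<close> by (auto simp add: less_top dest!: ennreal_suminf_lessD)
    then have "\<exists>E\<in>hausdorff_covers \<delta> (A n). ?w E < hausdorff_content k \<delta> (A n) + ennreal (e * (1/2) ^ Suc n)"
      by (subst (asm) hausdorff_content_def) (simp only: INF_less_iff)
    then show ?thesis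
      by (meson less_imp_le)
  qed
  then obtain E where E: "\<And>n. E n \<in> hausdorff_covers \<delta> (A n)"
    and Ew: "\<And>n. ?w (E n) \<le> hausdorff_content k \<delta> (A n) + ennreal (e * (1/2) ^ Suc n)"
    by metis
  define F where "F = (\<lambda>m. case_prod E (prod_decode m))"
  have "(\<Union>n. A n) \<subseteq> (\<Union>m. F m)"
  proof
    fix x assume "x \<in> (\<Union>n. A n)"
    then obtain n where "x \<in> A n" by auto
    then obtain i where "x \<in> E n i" using E[of n] by (auto simp: hausdorff_covers_def)
    then have "x \<in> F (prod_encode (n, i))" by (simp add: F_def)
    then show "x \<in> (\<Union>m. F m)" by blast
  qed
  moreover have "bounded (F m) \<and> diameter (F m) \<le> \<delta>" for m
    using E by (auto simp: F_def hausdorff_covers_def split: prod.split)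
  ultimately have "F \<in> hausdorff_covers \<delta> (\<Union>n. A n)"
    by (auto simp: hausdorff_covers_def)
  then have "hausdorff_content k \<delta> (\<Union>n. A n) \<le> ?w F"
    unfolding hausdorff_content_def by (rule INF_lower)
  also have "?w F = (\<Sum>n. ?w (E n))"
  proof -
    have "(\<Sum>m. (\<lambda>(n, i). hausdorff_weight k (E n i)) (prod_decode m)) = (\<Sum>n. ?w (E n))"
      by (rule suminf_ennreal_2dimen) simp
    then show ?thesis by (simp add: F_def case_prod_unfold)
  qed
  also have "\<dots> \<le> (\<Sum>n. hausdorff_content k \<delta> (A n) + ennreal (e * (1/2) ^ Suc n))"
    by (intro suminf_le Ew) auto
  also have "\<dots> = (\<Sum>n. hausdorff_content k \<delta> (A n)) + (\<Sum>n. ennreal (e * (1/2) ^ Suc n))"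
    by (rule suminf_add[symmetric]) auto
  also have "(\<Sum>n. ennreal (e * (1/2) ^ Suc n)) = ennreal e"
  proof (rule suminf_ennreal_eq)
    show "0 \<le> e * (1/2) ^ Suc n" for n using \<open>0 < e\<close> by simp
    show "(\<lambda>n. e * (1/2) ^ Suc n) sums e"
      using sums_mult[OF power_half_series, of e] by simp
  qed
  finally show "hausdorff_content k \<delta> (\<Union>n. A n) \<le> (\<Sum>n. hausdorff_content k \<delta> (A n)) + ennreal e" .
qed

lemma outer_measure_space_hausdorff_outer: "outer_measure_space UNIV (hausdorff_outer k :: 'a::metric_space set \<Rightarrow> ennreal)"
  unfolding outer_measure_space_def
proof (intro conjI)
  show "positive UNIV (hausdorff_outer k :: 'a set \<Rightarrow> ennreal)"
    by (auto simp: positive_def hausdorff_outer_def hausdorff_content_empty image_constant_conv)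
  show "increasing UNIV (hausdorff_outer k :: 'a set \<Rightarrow> ennreal)"
    by (auto simp: increasing_def hausdorff_outer_def intro!: SUP_mono hausdorff_content_mono)
  show "countably_subadditive UNIV (hausdorff_outer k :: 'a set \<Rightarrow> ennreal)"
    unfolding countably_subadditive_def
  proof (intro allI impI)
    fix A :: "nat \<Rightarrow> 'a set"
    show "hausdorff_outer k (\<Union>n. A n) \<le> (\<Sum>n. hausdorff_outer k (A n))"
      unfolding hausdorff_outer_def[of k "\<Union>n. A n"]
    proof (rule SUP_least)
      fix \<delta> :: real assume \<delta>: "\<delta> \<in> {0<..}"
      have "hausdorff_content k \<delta> (\<Union>n. A n) \<le> (\<Sum>n. hausdorff_content k \<delta> (A n))"
        by (rule hausdorff_content_UN)
      also have "\<dots> \<le> (\<Sum>n. hausdorff_outer k (A n))"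
        unfolding hausdorff_outer_def by (intro suminf_le SUP_upper \<delta>) auto
      finally show "hausdorff_content k \<delta> (\<Union>n. A n) \<le> (\<Sum>n. hausdorff_outer k (A n))" .
    qed
  qed
qed

lemma measure_space_hausdorff:
  "measure_space UNIV (lambda_system UNIV UNIV (hausdorff_outer k)) (hausdorff_outer k)"
  using sigma_algebra.caratheodory_lemma[OF sigma_algebra_Pow[of UNIV], unfolded Pow_UNIV,
      OF outer_measure_space_hausdorff_outer] .

lemma sigma_algebra_hausdorff:
  "sigma_algebra UNIV (lambda_system UNIV UNIV (hausdorff_outer k))"
  by (rule measure_space_hausdorff[unfolded measure_space_def, THEN conjunct1])

lemma space_hausdorff_measure [simp]: "space (hausdorff_measure k) = UNIV"
  by (simp add: hausdorff_measure_def space_measure_of)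

lemma sets_hausdorff_measure:
  "sets (hausdorff_measure k) = lambda_system UNIV UNIV (hausdorff_outer k)"
  unfolding hausdorff_measure_def
  by (rule sigma_algebra.sets_measure_of_eq[OF sigma_algebra_hausdorff])

lemma emeasure_hausdorff_measure:
  assumes "A \<in> sets (hausdorff_measure k)"
  shows "emeasure (hausdorff_measure k) A = hausdorff_outer k A"
  unfolding hausdorff_measure_def
proof (rule emeasure_measure_of_sigma[OF sigma_algebra_hausdorff])
  show "positive (lambda_system UNIV UNIV (hausdorff_outer k)) (hausdorff_outer k)"
    "countably_additive (lambda_system UNIV UNIV (hausdorff_outer k)) (hausdorff_outer k)"
    by (rule measure_space_hausdorff[unfolded measure_space_def, THEN conjunct2, THEN conjunct1],
        rule measure_space_hausdorff[unfolded measure_space_def, THEN conjunct2, THEN conjunct2])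
  show "A \<in> lambda_system UNIV UNIV (hausdorff_outer k)"
    using assms by (simp only: sets_hausdorff_measure)
qed

definition vol :: "'a::euclidean_space measure" where
  "vol = hausdorff_measure DIM('a)"


section \<open>Smooth functions and smooth domains in the sphere\<close>

text \<open>Meaningful for open \<open>S\<close> only; \<open>k\<close>-fold continuous differentiability via directional derivatives.\<close>

fun Ck_on :: "nat \<Rightarrow> ('a::real_normed_vector \<Rightarrow> 'b::real_normed_vector) \<Rightarrow> 'a set \<Rightarrow> bool" where
  "Ck_on 0 f S \<longleftrightarrow> continuous_on S f"
| "Ck_on (Suc k) f S \<longleftrightarrow>
     (\<forall>x\<in>S. f differentiable (at x)) \<and> (\<forall>v. Ck_on k (\<lambda>x. frechet_derivative f (at x) v) S)"

definition smooth_on :: "('a::real_normed_vector \<Rightarrow> 'b::real_normed_vector) \<Rightarrow> 'a set \<Rightarrow> bool" where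
  "smooth_on f S \<longleftrightarrow> (\<forall>k. Ck_on k f S)"

text \<open>
  \<open>C\<close> is a relatively open subset of the unit sphere. Near each point of its boundary in the
  sphere it is one side \<open>{f < 0}\<close> of the zero set of a smooth function whose restriction to the
  sphere has nonzero differential there: \<open>v\<close> below ranges over the tangent space of the sphere.
\<close>

definition smooth_boundary_in_sphere :: "'a::euclidean_space set \<Rightarrow> bool" where
  "smooth_boundary_in_sphere C \<longleftrightarrow>
     (\<forall>p \<in> top_of_set (sphere 0 1) frontier_of C.
        \<exists>U (f :: 'a \<Rightarrow> real). open U \<and> p \<in> U \<and> smooth_on f U \<and>
          (\<exists>v. v \<bullet> p = 0 \<and> frechet_derivative f (at p) v \<noteq> 0) \<and>
          C \<inter> U = {x \<in> sphere 0 1 \<inter> U. f x < 0})"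

definition cone_over :: "'a::real_vector set \<Rightarrow> 'a set" where
  "cone_over C = {t *\<^sub>R p | t p. t > 0 \<and> p \<in> C}"


section \<open>Relative perimeter and isoperimetric regions\<close>

definition divergence :: "('a::euclidean_space \<Rightarrow> 'a) \<Rightarrow> 'a \<Rightarrow> real" where
  "divergence Y x = (\<Sum>b\<in>Basis. frechet_derivative Y (at x) b \<bullet> b)"

text \<open>
  A vector field on the open set \<open>M\<close> with compact support in \<open>M\<close> is represented by its extension
  by zero to the whole space.
\<close>

definition test_fields :: "'a::euclidean_space set \<Rightarrow> ('a \<Rightarrow> 'a) set" where
  "test_fields M =
     {Y. smooth_on Y M \<and> compact (closure {x. Y x \<noteq> 0}) \<and> closure {x. Y x \<noteq> 0} \<subseteq> M \<and>
         (\<forall>x. norm (Y x) \<le> 1)}"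

definition perimeter :: "'a::euclidean_space set \<Rightarrow> 'a set \<Rightarrow> ereal" where
  "perimeter M \<Omega> = (SUP Y\<in>test_fields M. ereal (LINT x:\<Omega>|vol. divergence Y x))"

definition sets_of_volume :: "'a::euclidean_space set \<Rightarrow> real \<Rightarrow> 'a set set" where
  "sets_of_volume M V = {E. E \<subseteq> M \<and> E \<in> sets vol \<and> emeasure vol E = ennreal V}"

definition isoperimetric_region :: "'a::euclidean_space set \<Rightarrow> real \<Rightarrow> 'a set \<Rightarrow> bool" where
  "isoperimetric_region M V \<Omega> \<longleftrightarrow>
     0 < V \<and> \<Omega> \<in> sets_of_volume M V \<and>
     perimeter M \<Omega> = (INF E\<in>sets_of_volume M V. perimeter M E)"

text \<open>Boundary and balls are relative to \<open>M\<close>.\<close>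

definition normalized_in :: "'a::euclidean_space set \<Rightarrow> 'a set \<Rightarrow> bool" where
  "normalized_in M \<Omega> \<longleftrightarrow>
     (\<forall>p \<in> top_of_set M frontier_of \<Omega>. \<forall>r>0.
        0 < emeasure vol (\<Omega> \<inter> (ball p r \<inter> M)) \<and>
        emeasure vol (\<Omega> \<inter> (ball p r \<inter> M)) < emeasure vol (ball p r \<inter> M))"

end

theory Submission
  imports Defs
begin

text \<open>
  A cone is invariant under dilations, so perimeter and volume scale, and the mere existence of an
  isoperimetric region \<open>\<Omega>\<close> of volume \<open>V\<close> gives the isoperimetric inequality
  \<open>P(E) \<ge> (vol E / V)^((d-1)/d) P(\<Omega>)\<close> for all \<open>E \<subseteq> M\<close> of finite volume, where \<open>d = n + 1\<close> and
  \<open>0 < P(\<Omega>) < \<infinity>\<close>. Apply it to the two pieces into which a sphere of radius \<open>r\<close> cuts \<open>\<Omega>\<close>; the sum of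
  their perimeters exceeds \<open>P(\<Omega>)\<close> by at most a constant times the area \<open>-v'(r)\<close> of the cut, where
  \<open>v(r)\<close> is the volume of \<open>\<Omega>\<close> outside the ball of radius \<open>r\<close>. As \<open>(1 - w)^((d-1)/d) \<ge> 1 - w\<close>, this
  leads to \<open>-v' \<ge> c v^((d-1)/d)\<close> for large \<open>r\<close>. So \<open>v^(1/d)\<close> decreases at least linearly and vanishes
  at a finite radius, and by the normalization \<open>\<Omega>\<close> has no points beyond it.

  The identity of \<open>vol\<close> with Lebesgue measure is never needed: it suffices that \<open>vol\<close> is a
  translation invariant Borel measure that scales, is finite on bounded sets and is not zero.
\<close>

section \<open>Hausdorff measure: Borel sets and scaling\<close>

text \<open>The area of the cut is never defined: \<open>v\<close> is monotone, but no derivative of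
  it is at hand, and perimeter is a supremum over test fields rather than a measure. Two devices
  replace the coarea formula. Test fields for the two pieces are blended across a shell of thickness
  \<epsilon>; the loss is governed by the volume of the shell divided by \<epsilon>, so that a bound
  \<open>D * \<epsilon>\<close> on the volumes of thin shells can stand for the area. And the
  differential inequality is obtained by contradiction: if the tail dropped too slowly on [a, r),
  the shells at r would be thin, the cut cheap, and the isoperimetric inequality violated. This
  gives sufficient decay only from some earlier radius; monotonicity and an infimum argument spread
  it over whole intervals. P(\<Omega>) > 0 keeps the inequality from being vacuous; it holds because
  a small ball in a cone can be moved to infinity without leaving the cone. P(\<Omega>) <
  \<infinity> is what allows P(\<Omega>) to be cancelled; the competitor is \<open>M\<close> cut by
  a ball, and its perimeter is controlled by the same cutting lemma because P(M) = 0.\<close>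

lemma hausdorff_outer_mono: "A \<subseteq> B \<Longrightarrow> hausdorff_outer k A \<le> hausdorff_outer k B"
  unfolding hausdorff_outer_def by (intro SUP_mono) (auto intro: hausdorff_content_mono)

lemma hausdorff_outer_empty [simp]: "hausdorff_outer k {} = 0"
  by (auto simp: hausdorff_outer_def hausdorff_content_empty image_constant_conv)

lemma hausdorff_outer_UN: "hausdorff_outer k (\<Union>n::nat. A n) \<le> (\<Sum>n. hausdorff_outer k (A n))"
  unfolding hausdorff_outer_def[of k "\<Union>n. A n"]
proof (rule SUP_least)
  fix \<delta> :: real assume \<delta>: "\<delta> \<in> {0<..}"
  have "hausdorff_content k \<delta> (\<Union>n. A n) \<le> (\<Sum>n. hausdorff_content k \<delta> (A n))"
    by (rule hausdorff_content_UN)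
  also have "\<dots> \<le> (\<Sum>n. hausdorff_outer k (A n))"
    unfolding hausdorff_outer_def by (intro suminf_le SUP_upper \<delta>) auto
  finally show "hausdorff_content k \<delta> (\<Union>n. A n) \<le> (\<Sum>n. hausdorff_outer k (A n))" .
qed

lemma hausdorff_content_le_UN_finite:
  assumes "0 < \<delta>" "finite I" "A \<subseteq> (\<Union>i\<in>I. B i)"
  shows "hausdorff_content k \<delta> A \<le> (\<Sum>i\<in>I. hausdorff_content k \<delta> (B i))"
proof -
  obtain h where h: "bij_betw h {..<card I} I"
    using ex_bij_betw_nat_finite[OF assms(2)] by (auto simp: atLeast0LessThan)
  define D where "D n = (if n < card I then B (h n) else {})" for n
  have "A \<subseteq> (\<Union>n. D n)"
  proof
    fix x assume "x \<in> A"
    then obtain i where "i \<in> I" "x \<in> B i" using assms by auto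
    moreover then obtain n where "n < card I" "h n = i" using h by (force simp: bij_betw_def)
    ultimately show "x \<in> (\<Union>n. D n)" by (auto simp: D_def)
  qed
  then have "hausdorff_content k \<delta> A \<le> (\<Sum>n. hausdorff_content k \<delta> (D n))"
    using hausdorff_content_UN[of k \<delta> D] hausdorff_content_mono order_trans by blast
  also have "\<dots> = (\<Sum>n<card I. hausdorff_content k \<delta> (D n))"
    by (rule suminf_finite) (auto simp: D_def hausdorff_content_empty assms(1))
  also have "\<dots> = (\<Sum>n<card I. hausdorff_content k \<delta> (B (h n)))" by (simp add: D_def)
  also have "\<dots> = (\<Sum>i\<in>I. hausdorff_content k \<delta> (B i))"
    by (rule sum.reindex_bij_betw[OF h])
  finally show ?thesis .
qed

lemma hausdorff_outer_Un: "hausdorff_outer k (A \<union> B) \<le> hausdorff_outer k A + hausdorff_outer k B"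
proof -
  have "hausdorff_outer k (\<Union>n. binaryset A B n) \<le> (\<Sum>n. hausdorff_outer k (binaryset A B n))"
    by (rule hausdorff_outer_UN)
  then show ?thesis by (simp add: UN_binaryset_eq suminf_binaryset_eq)
qed

section \<open>Additivity on separated sets and Borel measurability\<close>

lemma hausdorff_content_antimono:
  "\<delta> \<le> \<delta>' \<Longrightarrow> hausdorff_content k \<delta>' A \<le> hausdorff_content k \<delta> A"
  unfolding hausdorff_content_def
  by (rule INF_superset_mono) (auto simp: hausdorff_covers_def intro: order_trans)

text \<open>A covering set of diameter at most \<delta> cannot meet both \<open>A\<close> and
  \<open>B\<close>, so every cover of the union splits into a cover of \<open>A\<close> and a cover
  of \<open>B\<close> without sharing any weight.\<close>

lemma hausdorff_content_add_separated:
  assumes sep: "\<And>x y. x \<in> A \<Longrightarrow> y \<in> B \<Longrightarrow> \<delta> < dist x y"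
  shows "hausdorff_content k \<delta> A + hausdorff_content k \<delta> B \<le> hausdorff_content k \<delta> (A \<union> B)"
  unfolding hausdorff_content_def[of k \<delta> "A \<union> B"]
proof (rule INF_greatest)
  fix E assume E: "E \<in> hausdorff_covers \<delta> (A \<union> B)"
  let ?w = "hausdorff_weight k"
  define F where "F X i = (if E i \<inter> X \<noteq> {} then E i else {})" for X i
  have F: "F X \<in> hausdorff_covers \<delta> X" if "X \<subseteq> A \<union> B" for X
  proof -
    have "X \<subseteq> (\<Union>i. F X i)" using E that by (fastforce simp: hausdorff_covers_def F_def)
    moreover have "0 \<le> \<delta>" using E diameter_ge_0
      by (metis (lifting) hausdorff_covers_def mem_Collect_eq order_trans)
    ultimately show ?thesis using E by (auto simp: hausdorff_covers_def F_def)
  qed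
  have w: "?w (F A i) + ?w (F B i) \<le> ?w (E i)" for i
  proof (cases "E i \<inter> A = {} \<or> E i \<inter> B = {}")
    case True then show ?thesis by (auto simp: F_def hausdorff_weight_def)
  next
    case False
    then obtain x y where "x \<in> E i" "x \<in> A" "y \<in> E i" "y \<in> B" by auto
    moreover have "bounded (E i)" "diameter (E i) \<le> \<delta>" using E by (auto simp: hausdorff_covers_def)
    ultimately have "x \<in> A" "y \<in> B" "dist x y \<le> \<delta>"
      using diameter_bounded_bound[of "E i" x y] by auto
    then show ?thesis using sep by force
  qed
  have "hausdorff_content k \<delta> A + hausdorff_content k \<delta> B \<le> (\<Sum>i. ?w (F A i)) + (\<Sum>i. ?w (F B i))"
    unfolding hausdorff_content_def using F by (intro add_mono INF_lower) auto
  also have "\<dots> = (\<Sum>i. ?w (F A i) + ?w (F B i))" by (rule suminf_add) auto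
  also have "\<dots> \<le> (\<Sum>i. ?w (E i))" by (intro suminf_le w) auto
  finally show "hausdorff_content k \<delta> A + hausdorff_content k \<delta> B \<le> (\<Sum>i. ?w (E i))" .
qed

lemma hausdorff_outer_add_separated:
  assumes "0 < \<eta>" and sep: "\<And>x y. x \<in> A \<Longrightarrow> y \<in> B \<Longrightarrow> \<eta> \<le> dist x y"
  shows "hausdorff_outer k A + hausdorff_outer k B \<le> hausdorff_outer k (A \<union> B)"
proof -
  \<comment> \<open>Two independent scales, so that the two suprema can be taken one after the
    other. A common scale strictly below \<eta> dominates both.\<close>
  have *: "hausdorff_content k \<delta>1 A + hausdorff_content k \<delta>2 B \<le> hausdorff_outer k (A \<union> B)"
    if "0 < \<delta>1" "0 < \<delta>2" for \<delta>1 \<delta>2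
  proof -
    define \<delta> where "\<delta> = min (min \<delta>1 \<delta>2) (\<eta>/2)"
    have d: "0 < \<delta>" "\<delta> \<le> \<delta>1" "\<delta> \<le> \<delta>2" "\<delta> < \<eta>" using that assms(1) by (auto simp: \<delta>_def)
    have "hausdorff_content k \<delta>1 A + hausdorff_content k \<delta>2 B
        \<le> hausdorff_content k \<delta> A + hausdorff_content k \<delta> B"
      by (intro add_mono hausdorff_content_antimono d)
    also have "\<dots> \<le> hausdorff_content k \<delta> (A \<union> B)"
      using sep d by (intro hausdorff_content_add_separated) force
    also have "\<dots> \<le> hausdorff_outer k (A \<union> B)"
      unfolding hausdorff_outer_def using d by (intro SUP_upper) auto
    finally show ?thesis .
  qed
  have ne: "{0::real<..} \<noteq> {}" by (simp add: ex_in_conv[symmetric])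
  have "hausdorff_outer k A + hausdorff_content k \<delta>2 B \<le> hausdorff_outer k (A \<union> B)"
    if "0 < \<delta>2" for \<delta>2
    unfolding hausdorff_outer_def[of k A] ennreal_SUP_add_left[OF ne, symmetric]
    using * that by (intro SUP_least) auto
  then show ?thesis
    unfolding hausdorff_outer_def[of k B] ennreal_SUP_add_right[OF ne]
    by (intro SUP_least) auto
qed

text \<open>Caratheodory's criterion: the shells around \<open>F\<close> at distance about \<open>1/n\<close> are separated from
  every second one, so their outer measures are summable and the shells close to \<open>F\<close> are negligible.\<close>

lemma closed_in_sets_hausdorff_measure:
  fixes F :: "'a::metric_space set"
  assumes "closed F"
  shows "F \<in> sets (hausdorff_measure k)"
proof (cases "F = {}")
  case False
  let ?\<mu> = "hausdorff_outer k :: 'a set \<Rightarrow> ennreal"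
  have main: "?\<mu> (A \<inter> F) + ?\<mu> (A - F) \<le> ?\<mu> A" if fin: "?\<mu> A < top" for A
  proof -
    define R where "R n = {x \<in> A. 1 / (real n + 1) \<le> infdist x F}" for n
    define D where "D n = {x \<in> A. 1 / (real n + 2) \<le> infdist x F \<and> infdist x F < 1 / (real n + 1)}" for n
    \<comment> \<open>Points of \<open>D m\<close> have distance at least 1/(m+2) \<ge> 1/n from
      \<open>F\<close>, points of \<open>D n\<close> less than 1/(n+1). The bound 1/n is weakened to
      1/(n+1/2) so that the gap is positive for n = 0 too, where 1/n would be 0 by
      convention.\<close>
    have gap: "1 / (real n + 1/2) - 1 / (real n + 1) \<le> dist x y"
      if "x \<in> D m" "m + 2 \<le> n" "y \<in> D n" for x y m n
    proof -
      have "1 / (real n + 1/2) \<le> 1 / (real m + 2)" using that by (intro divide_left_mono) auto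
      also have "\<dots> \<le> infdist x F" using that by (simp add: D_def)
      also have "\<dots> \<le> infdist y F + dist x y" by (rule infdist_triangle)
      finally show ?thesis using that by (simp add: D_def)
    qed
    have half: "(\<Sum>j<N. ?\<mu> (D (2*j+i))) \<le> ?\<mu> (\<Union>j<N. D (2*j+i))" for i N
    proof (induction N)
      case (Suc N)
      have "(\<Sum>j<Suc N. ?\<mu> (D (2*j+i))) \<le> ?\<mu> (\<Union>j<N. D (2*j+i)) + ?\<mu> (D (2*N+i))"
        using Suc by (simp add: add_right_mono)
      also have "\<dots> \<le> ?\<mu> ((\<Union>j<N. D (2*j+i)) \<union> D (2*N+i))"
      proof (rule hausdorff_outer_add_separated)
        show "0 < 1 / (real (2*N+i) + 1/2) - 1 / (real (2*N+i) + 1)"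
          by (simp add: field_simps add_pos_nonneg)
        fix x y assume "x \<in> (\<Union>j<N. D (2*j+i))" "y \<in> D (2*N+i)"
        then obtain j where "j < N" "x \<in> D (2*j+i)" by auto
        then show "1 / (real (2*N+i) + 1/2) - 1 / (real (2*N+i) + 1) \<le> dist x y"
          using \<open>y \<in> D (2*N+i)\<close> by (intro gap[of x "2*j+i"]) auto
      qed
      also have "(\<Union>j<N. D (2*j+i)) \<union> D (2*N+i) = (\<Union>j<Suc N. D (2*j+i))"
        by (auto simp: less_Suc_eq)
      finally show ?case .
    qed simp
    have half': "(\<Sum>j<N. ?\<mu> (D (2*j+i))) \<le> ?\<mu> A" for i N
      by (rule order_trans[OF half hausdorff_outer_mono]) (auto simp: D_def)
    have even_odd: "(\<Sum>n<2*N. g n) = (\<Sum>j<N. g (2*j+0)) + (\<Sum>j<N. g (2*j+1))" for g :: "nat \<Rightarrow> ennreal" and N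
      by (induction N) (auto simp: ac_simps)
    have partial: "(\<Sum>n<N. ?\<mu> (D n)) \<le> 2 * ?\<mu> A" for N
    proof -
      have "(\<Sum>n<N. ?\<mu> (D n)) \<le> (\<Sum>n<2*N. ?\<mu> (D n))" by (rule sum_mono2) auto
      also have "\<dots> \<le> ?\<mu> A + ?\<mu> A" unfolding even_odd by (intro add_mono half')
      finally show ?thesis by (simp add: mult_2)
    qed
    have Dfin: "?\<mu> (D n) < top" for n
      using fin hausdorff_outer_mono[of "D n" A k] by (auto simp: D_def intro: le_less_trans)
    define d where "d n = enn2real (?\<mu> (D n))" for n
    have d: "?\<mu> (D n) = ennreal (d n)" "0 \<le> d n" for n using Dfin[of n] by (auto simp: d_def)
    have "summable d"
    proof (rule summableI_nonneg_bounded)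
      fix N
      have "ennreal (\<Sum>n<N. d n) \<le> 2 * ?\<mu> A" using partial[of N] by (simp add: d)
      then show "(\<Sum>n<N. d n) \<le> enn2real (2 * ?\<mu> A)"
        using fin by (subst (asm) ennreal_enn2real[symmetric, of "2 * ?\<mu> A"])
          (auto simp: ennreal_mult_less_top simp del: ennreal_enn2real)
    qed (rule d)
    have bound: "?\<mu> (A \<inter> F) + ?\<mu> (A - F) \<le> ?\<mu> A + ennreal e" if "0 < e" for e
    proof -
      obtain N where N: "norm (\<Sum>i. d (i + n)) < e" if "n \<ge> N" for n
        using suminf_exist_split[OF \<open>0 < e\<close> \<open>summable d\<close>] by auto
      have "A - F \<subseteq> R N \<union> (\<Union>i. D (i + N))"
      proof
        fix x assume x: "x \<in> A - F"
        show "x \<in> R N \<union> (\<Union>i. D (i + N))"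
        proof (cases "x \<in> R N")
          case False
          have pos: "0 < infdist x F"
            using x assms \<open>F \<noteq> {}\<close> in_closed_iff_infdist_zero[of F x] infdist_nonneg[of x F] by force
          have ex: "\<exists>n. 1 / (real n + 1) \<le> infdist x F"
            using reals_Archimedean[OF pos] by (auto simp: inverse_eq_divide add.commute intro: less_imp_le)
          \<comment> \<open>Minimality gives 1/(n+1) \<le> \<open>infdist x F\<close> < 1/n, which
            is the shell of index n - 1; the subtraction is harmless because n > N.\<close>
          define n where "n = (LEAST n. 1 / (real n + 1) \<le> infdist x F)"
          have n1: "1 / (real n + 1) \<le> infdist x F" unfolding n_def by (rule LeastI_ex[OF ex])
          have nN: "N < n"
          proof (rule ccontr)
            assume "\<not> N < n"
            then have "1 / (real N + 1) \<le> 1 / (real n + 1)" by (intro divide_left_mono) auto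
            then show False using False x n1 by (auto simp: R_def)
          qed
          have "\<not> 1 / (real (n-1) + 1) \<le> infdist x F"
            using nN unfolding n_def by (intro not_less_Least) auto
          then have "x \<in> D (n - 1)" using n1 nN x by (auto simp: D_def of_nat_diff add.commute)
          moreover have "n - 1 = (n - 1 - N) + N" using nN by auto
          ultimately show ?thesis by (metis UN_I UNIV_I UnI2)
        qed simp
      qed
      then have "?\<mu> (A - F) \<le> ?\<mu> (R N) + ?\<mu> (\<Union>i. D (i + N))"
        using hausdorff_outer_mono hausdorff_outer_Un order_trans by meson
      also have "?\<mu> (\<Union>i. D (i + N)) \<le> (\<Sum>i. ?\<mu> (D (i + N)))" by (rule hausdorff_outer_UN)
      also have "\<dots> = ennreal (\<Sum>i. d (i + N))"
        unfolding d using \<open>summable d\<close> by (intro suminf_ennreal2) (auto simp: d summable_iff_shift)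
      also have "\<dots> \<le> ennreal e" using N[of N] by (auto intro: ennreal_leI)
      finally have "?\<mu> (A - F) \<le> ?\<mu> (R N) + ennreal e" by (simp add: add_left_mono)
      then have "?\<mu> (A \<inter> F) + ?\<mu> (A - F) \<le> (?\<mu> (A \<inter> F) + ?\<mu> (R N)) + ennreal e"
        unfolding add.assoc by (rule add_left_mono)
      also have "?\<mu> (A \<inter> F) + ?\<mu> (R N) \<le> ?\<mu> ((A \<inter> F) \<union> R N)"
      proof (rule hausdorff_outer_add_separated[of "1 / (real N + 1)"])
        fix x y assume "x \<in> A \<inter> F" "y \<in> R N"
        then show "1 / (real N + 1) \<le> dist x y"
          using infdist_le[of x F y] by (auto simp: R_def dist_commute)
      qed auto
      also have "?\<mu> ((A \<inter> F) \<union> R N) \<le> ?\<mu> A" by (rule hausdorff_outer_mono) (auto simp: R_def)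
      finally show ?thesis by (simp add: add_right_mono)
    qed
    show ?thesis by (rule ennreal_le_epsilon) (use bound in auto)
  qed
  have "?\<mu> (F \<inter> A) + ?\<mu> ((UNIV - F) \<inter> A) = ?\<mu> A" for A
  proof (rule antisym)
    have eq: "F \<inter> A = A \<inter> F" "(UNIV - F) \<inter> A = A - F" by auto
    show "?\<mu> (F \<inter> A) + ?\<mu> ((UNIV - F) \<inter> A) \<le> ?\<mu> A"
      unfolding eq using main[of A] by (cases "?\<mu> A = top") (auto simp: top.not_eq_extremum)
    have "(F \<inter> A) \<union> ((UNIV - F) \<inter> A) = A" by auto
    then show "?\<mu> A \<le> ?\<mu> (F \<inter> A) + ?\<mu> ((UNIV - F) \<inter> A)"
      using hausdorff_outer_Un[of k "F \<inter> A" "(UNIV - F) \<inter> A"] by simp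
  qed
  then show ?thesis by (auto simp: sets_hausdorff_measure lambda_system_def)
qed (metis sets.empty_sets)

lemma sets_borel_subset_vol: "sets borel \<subseteq> sets (vol :: 'a::euclidean_space measure)"
proof -
  have "Collect closed \<subseteq> sets (vol :: 'a measure)"
    by (auto simp: vol_def closed_in_sets_hausdorff_measure)
  from sets.sigma_sets_subset[OF this] show ?thesis
    by (simp add: borel_eq_closed vol_def)
qed

lemma space_vol [simp]: "space vol = UNIV"
  by (simp add: vol_def)

lemma borel_sets_vol [simp]: "A \<in> sets borel \<Longrightarrow> A \<in> sets vol"
  using sets_borel_subset_vol by auto

lemma borel_measurable_vol: "f \<in> borel_measurable borel \<Longrightarrow> f \<in> borel_measurable vol"
  by (auto simp: measurable_def)

lemma emeasure_vol: "A \<in> sets vol \<Longrightarrow> emeasure vol A = hausdorff_outer DIM('a) A"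
  for A :: "'a::euclidean_space set"
  by (simp add: vol_def emeasure_hausdorff_measure)

section \<open>Dilations and translations\<close>

lemma ennreal_le_mult_INF:
  fixes c :: real
  assumes "0 < c" "\<And>i. i \<in> I \<Longrightarrow> z \<le> ennreal c * f i"
  shows "z \<le> ennreal c * (INF i\<in>I. f i)"
proof -
  have c: "0 < ennreal c" "ennreal c \<noteq> 0" "ennreal c \<noteq> top" using assms(1) by auto
  have "z / ennreal c \<le> (INF i\<in>I. f i)"
    by (intro INF_greatest divide_le_posI_ennreal c assms)
  then have "z / ennreal c * ennreal c \<le> ennreal c * (INF i\<in>I. f i)"
    by (metis mult.commute mult_left_mono zero_le)
  then show ?thesis using c by (simp add: ennreal_divide_times mult_divide_eq_ennreal)
qed

lemma bounded_affine_image: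
  fixes E :: "'a::real_normed_vector set"
  shows "bounded E \<Longrightarrow> bounded ((\<lambda>x. a + t *\<^sub>R x) ` E)"
  using bounded_translation[OF bounded_scaling, of E a t] by (simp add: image_image)

lemma diameter_affine_le:
  fixes E :: "'a::real_normed_vector set"
  assumes "bounded E" "0 < t"
  shows "diameter ((\<lambda>x. a + t *\<^sub>R x) ` E) \<le> t * diameter E"
proof (rule diameter_le)
  show "(\<lambda>x. a + t *\<^sub>R x) ` E \<noteq> {} \<or> 0 \<le> t * diameter E"
    using assms diameter_ge_0 by auto
  fix x y assume "x \<in> (\<lambda>x. a + t *\<^sub>R x) ` E" "y \<in> (\<lambda>x. a + t *\<^sub>R x) ` E"
  then obtain u v where uv: "u \<in> E" "v \<in> E" "x = a + t *\<^sub>R u" "y = a + t *\<^sub>R v" by auto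
  then have "x - y = t *\<^sub>R (u - v)" by (simp add: scaleR_diff_right)
  then have "norm (x - y) = t * dist u v" using assms by (simp add: dist_norm)
  also have "\<dots> \<le> t * diameter E"
    using assms uv diameter_bounded_bound by (intro mult_left_mono) auto
  finally show "norm (x - y) \<le> t * diameter E" .
qed

lemma hausdorff_weight_affine_le:
  fixes E :: "'a::real_normed_vector set"
  assumes "bounded E" "0 < t"
  shows "hausdorff_weight k ((\<lambda>x. a + t *\<^sub>R x) ` E) \<le> ennreal (t ^ k) * hausdorff_weight k E"
proof (cases "E = {}")
  case False
  have nn: "0 \<le> diameter ((\<lambda>x. a + t *\<^sub>R x) ` E)"
    by (intro diameter_ge_0 bounded_affine_image assms)
  have "unit_ball_vol (real k) * (diameter ((\<lambda>x. a + t *\<^sub>R x) ` E) / 2) ^ k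
      \<le> unit_ball_vol (real k) * (t * (diameter E / 2)) ^ k"
    using diameter_affine_le[OF assms, of a] nn by (intro mult_left_mono power_mono) auto
  also have "\<dots> = t ^ k * (unit_ball_vol (real k) * (diameter E / 2) ^ k)"
    by (simp only: power_mult_distrib mult.left_commute)
  finally show ?thesis
    using False assms diameter_ge_0[OF assms(1)]
    by (auto simp: hausdorff_weight_def simp flip: ennreal_mult intro!: ennreal_leI)
qed (simp add: hausdorff_weight_def)

lemma hausdorff_content_affine_le:
  fixes A :: "'a::real_normed_vector set"
  assumes "0 < t"
  shows "hausdorff_content k (t * \<delta>) ((\<lambda>x. a + t *\<^sub>R x) ` A) \<le> ennreal (t ^ k) * hausdorff_content k \<delta> A"
  unfolding hausdorff_content_def[of k \<delta> A]
proof (rule ennreal_le_mult_INF)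
  fix E assume E: "E \<in> hausdorff_covers \<delta> A"
  let ?g = "\<lambda>x. a + t *\<^sub>R x"
  have bd: "bounded (E i)" "diameter (E i) \<le> \<delta>" for i using E by (auto simp: hausdorff_covers_def)
  have "diameter (?g ` E i) \<le> t * \<delta>" for i
    using diameter_affine_le[OF bd(1) assms, of a i] bd(2)[of i] assms
    by (meson mult_left_mono less_imp_le order_trans)
  then have "(\<lambda>i. ?g ` E i) \<in> hausdorff_covers (t * \<delta>) (?g ` A)"
    using E bounded_affine_image[OF bd(1)] by (fastforce simp: hausdorff_covers_def)
  then have "hausdorff_content k (t * \<delta>) (?g ` A) \<le> (\<Sum>i. hausdorff_weight k (?g ` E i))"
    unfolding hausdorff_content_def by (rule INF_lower)
  also have "\<dots> \<le> (\<Sum>i. ennreal (t ^ k) * hausdorff_weight k (E i))"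
    by (intro suminf_le hausdorff_weight_affine_le bd assms) auto
  also have "\<dots> = ennreal (t ^ k) * (\<Sum>i. hausdorff_weight k (E i))" by simp
  finally show "hausdorff_content k (t * \<delta>) (?g ` A) \<le> ennreal (t ^ k) * (\<Sum>i. hausdorff_weight k (E i))" .
qed (use assms in auto)

lemma hausdorff_outer_affine_le:
  fixes A :: "'a::real_normed_vector set"
  assumes "0 < t"
  shows "hausdorff_outer k ((\<lambda>x. a + t *\<^sub>R x) ` A) \<le> ennreal (t ^ k) * hausdorff_outer k A"
  unfolding hausdorff_outer_def[of k "(\<lambda>x. a + t *\<^sub>R x) ` A"]
proof (rule SUP_least)
  fix \<delta> :: real assume \<delta>: "\<delta> \<in> {0<..}"
  have "hausdorff_content k \<delta> ((\<lambda>x. a + t *\<^sub>R x) ` A) \<le> ennreal (t ^ k) * hausdorff_content k (\<delta> / t) A"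
    using hausdorff_content_affine_le[OF assms, of k "\<delta> / t" a A] assms by simp
  also have "\<dots> \<le> ennreal (t ^ k) * hausdorff_outer k A"
    unfolding hausdorff_outer_def using \<delta> assms by (intro mult_left_mono SUP_upper) auto
  finally show "hausdorff_content k \<delta> ((\<lambda>x. a + t *\<^sub>R x) ` A) \<le> ennreal (t ^ k) * hausdorff_outer k A" .
qed

lemma affine_image_inverse:
  fixes a :: "'a::real_vector"
  assumes "0 < t"
  shows "(\<lambda>x. - (1 / t) *\<^sub>R a + (1 / t) *\<^sub>R x) ` (\<lambda>x. a + t *\<^sub>R x) ` A = A"
  using assms by (simp add: image_image scaleR_add_right)

text \<open>The inverse map is again of this form, with factor 1/t. Applying the inequality to it
  gives the converse, since the two powers cancel.\<close>

lemma hausdorff_outer_affine: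
  fixes A :: "'a::real_normed_vector set"
  assumes "0 < t"
  shows "hausdorff_outer k ((\<lambda>x. a + t *\<^sub>R x) ` A) = ennreal (t ^ k) * hausdorff_outer k A"
proof (rule antisym[OF hausdorff_outer_affine_le[OF assms]])
  let ?B = "(\<lambda>x. a + t *\<^sub>R x) ` A"
  have "hausdorff_outer k A \<le> ennreal ((1 / t) ^ k) * hausdorff_outer k ?B"
    using hausdorff_outer_affine_le[of "1 / t" k "- (1 / t) *\<^sub>R a" ?B] assms
    unfolding affine_image_inverse[OF assms] by simp
  then have "ennreal (t ^ k) * hausdorff_outer k A
      \<le> ennreal (t ^ k) * (ennreal ((1 / t) ^ k) * hausdorff_outer k ?B)"
    by (rule mult_left_mono) simp
  also have "\<dots> = hausdorff_outer k ?B"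
    using assms by (simp add: mult.assoc[symmetric] power_one_over flip: ennreal_mult)
  finally show "ennreal (t ^ k) * hausdorff_outer k A \<le> hausdorff_outer k ?B" .
qed

text \<open>Caratheodory's condition is tested on all sets, and every test set is the image of
  another one. The outer measure only picks up a common factor, so the condition is carried
  over.\<close>

lemma sets_vol_affine:
  fixes A :: "'a::euclidean_space set"
  assumes A: "A \<in> sets vol" and t: "0 < t"
  shows "(\<lambda>x. a + t *\<^sub>R x) ` A \<in> sets vol"
proof -
  let ?g = "\<lambda>x. a + t *\<^sub>R x" and ?\<mu> = "hausdorff_outer DIM('a)"
  have inj: "inj ?g" using t by (auto simp: inj_on_def)
  have "?\<mu> (?g ` A \<inter> X) + ?\<mu> ((UNIV - ?g ` A) \<inter> X) = ?\<mu> X" for X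
  proof -
    define Y where "Y = (\<lambda>x. - (1 / t) *\<^sub>R a + (1 / t) *\<^sub>R x) ` X"
    have X: "X = ?g ` Y" using t by (simp add: Y_def image_image scaleR_add_right scaleR_diff_right)
    have eq: "?g ` A \<inter> X = ?g ` (A \<inter> Y)" "(UNIV - ?g ` A) \<inter> X = ?g ` ((UNIV - A) \<inter> Y)"
      unfolding X using inj by (auto simp: inj_def)
    have "?\<mu> (?g ` A \<inter> X) + ?\<mu> ((UNIV - ?g ` A) \<inter> X)
        = ennreal (t ^ DIM('a)) * (?\<mu> (A \<inter> Y) + ?\<mu> ((UNIV - A) \<inter> Y))"
      unfolding eq hausdorff_outer_affine[OF t] by (simp add: distrib_left)
    also have "?\<mu> (A \<inter> Y) + ?\<mu> ((UNIV - A) \<inter> Y) = ?\<mu> Y"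
      using A by (auto simp: vol_def sets_hausdorff_measure lambda_system_def)
    also have "ennreal (t ^ DIM('a)) * ?\<mu> Y = ?\<mu> X" unfolding X hausdorff_outer_affine[OF t] ..
    finally show ?thesis .
  qed
  then show ?thesis by (auto simp: vol_def sets_hausdorff_measure lambda_system_def)
qed

lemma emeasure_vol_affine:
  fixes A :: "'a::euclidean_space set"
  assumes "A \<in> sets vol" "0 < t"
  shows "emeasure vol ((\<lambda>x. a + t *\<^sub>R x) ` A) = ennreal (t ^ DIM('a)) * emeasure vol A"
  using assms by (simp add: emeasure_vol sets_vol_affine hausdorff_outer_affine)

lemma affine_vimage:
  fixes a :: "'a::real_vector"
  assumes "0 < t"
  shows "(\<lambda>x. a + t *\<^sub>R x) -` A = (\<lambda>x. - (1 / t) *\<^sub>R a + (1 / t) *\<^sub>R x) ` A"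
proof -
  have "x = - (1 / t) *\<^sub>R a + (1 / t) *\<^sub>R (a + t *\<^sub>R x)" for x
    using assms by (simp add: scaleR_add_right)
  moreover have "a + t *\<^sub>R (- (1 / t) *\<^sub>R a + (1 / t) *\<^sub>R x) = x" for x
    using assms by (simp add: scaleR_add_right scaleR_diff_right)
  ultimately show ?thesis by (auto simp: image_iff intro!: bexI)
qed

lemma measurable_vol_affine:
  fixes a :: "'a::euclidean_space"
  assumes "0 < t"
  shows "(\<lambda>x. a + t *\<^sub>R x) \<in> measurable vol vol"
proof (rule measurableI)
  fix A :: "'a set" assume "A \<in> sets vol"
  then show "(\<lambda>x. a + t *\<^sub>R x) -` A \<inter> space vol \<in> sets vol"
    unfolding affine_vimage[OF assms] using assms by (simp add: sets_vol_affine del: add_uminus_conv_diff scaleR_minus_left)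
qed simp

text \<open>The change of variables is put in this form so that the general rules for integrals
  against \<open>density\<close> and \<open>distr\<close> yield
  \<open>integral_vol_affine\<close>.\<close>

lemma vol_eq_density_distr:
  fixes a :: "'a::euclidean_space"
  assumes t: "0 < t"
  shows "vol = density (distr vol vol (\<lambda>x. a + t *\<^sub>R x)) (\<lambda>_. ennreal (t ^ DIM('a)))"
proof (rule measure_eqI)
  fix A :: "'a set" assume A: "A \<in> sets vol"
  have "emeasure (density (distr vol vol (\<lambda>x. a + t *\<^sub>R x)) (\<lambda>_. ennreal (t ^ DIM('a)))) A
      = ennreal (t ^ DIM('a)) * emeasure vol ((\<lambda>x. a + t *\<^sub>R x) -` A)"
    using A t by (simp add: emeasure_density nn_integral_cmult_indicator emeasure_distr
        measurable_vol_affine)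
  also have "\<dots> = ennreal (t ^ DIM('a)) * (ennreal ((1 / t) ^ DIM('a)) * emeasure vol A)"
    using t A by (simp add: affine_vimage emeasure_vol_affine del: scaleR_minus_left)
  also have "\<dots> = emeasure vol A"
    using t by (simp add: mult.assoc[symmetric] power_one_over flip: ennreal_mult)
  finally show "emeasure vol A = emeasure (density (distr vol vol (\<lambda>x. a + t *\<^sub>R x)) (\<lambda>_. ennreal (t ^ DIM('a)))) A" ..
qed simp

lemma integral_vol_affine:
  fixes f :: "'a::euclidean_space \<Rightarrow> real"
  assumes "f \<in> borel_measurable vol" "0 < t"
  shows "(LINT x|vol. f x) = t ^ DIM('a) * (LINT x|vol. f (a + t *\<^sub>R x))"
proof -
  have "(LINT x|vol. f x) = (LINT x|distr vol vol (\<lambda>x. a + t *\<^sub>R x). t ^ DIM('a) *\<^sub>R f x)"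
    using assms by (subst vol_eq_density_distr[OF assms(2), of a], subst integral_density) auto
  also have "\<dots> = (LINT x|vol. t ^ DIM('a) *\<^sub>R f (a + t *\<^sub>R x))"
    using assms by (intro integral_distr measurable_vol_affine) auto
  finally show ?thesis by simp
qed

section \<open>Finiteness on bounded sets and positivity on balls\<close>

lemma hausdorff_content_unit_cube_double:
  assumes "0 < \<delta>"
  shows "hausdorff_content DIM('a) \<delta> (cbox 0 One :: 'a::euclidean_space set)
    \<le> hausdorff_content DIM('a) (2 * \<delta>) (cbox 0 One :: 'a set)"
proof -
  let ?Q = "cbox 0 One :: 'a set" and ?d = "DIM('a)"
  let ?g = "\<lambda>S x. (1/2) *\<^sub>R \<Sum>S + (1/2) *\<^sub>R x :: 'a"
  \<comment> \<open>The unit cube is covered by 2^d copies of half its size, one at each vertex; the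
    vertices are the sums \<Sum>S over subsets of the basis. Halving multiplies the content by
    (1/2)^d while halving the scale, so the number of copies exactly compensates.\<close>
  have "?Q \<subseteq> (\<Union>S\<in>Pow Basis. ?g S ` ?Q)"
  proof
    fix x :: 'a assume x: "x \<in> ?Q"
    define S where "S = {b\<in>Basis. 1/2 \<le> x \<bullet> b}"
    define y where "y = 2 *\<^sub>R x - \<Sum>S"
    have "\<Sum>S \<bullet> b = (if b \<in> S then 1 else 0)" if "b \<in> Basis" for b
    proof -
      have "\<Sum>S \<bullet> b = (\<Sum>c\<in>S. c \<bullet> b)" by (simp add: inner_sum_left)
      also have "\<dots> = (\<Sum>c\<in>S. if c = b then 1 else 0)"
        using that by (intro sum.cong) (auto simp: S_def inner_Basis)
      finally show ?thesis by (simp add: S_def)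
    qed
    then have "y \<in> ?Q" using x by (auto simp: mem_box y_def inner_diff_left S_def)
    moreover have "x = ?g S y" by (simp add: y_def scaleR_diff_right)
    moreover have "S \<in> Pow Basis" by (auto simp: S_def)
    ultimately show "x \<in> (\<Union>S\<in>Pow Basis. ?g S ` ?Q)" by blast
  qed
  then have "hausdorff_content ?d \<delta> ?Q \<le> (\<Sum>S\<in>Pow (Basis::'a set). hausdorff_content ?d \<delta> (?g S ` ?Q))"
    by (intro hausdorff_content_le_UN_finite assms) auto
  also have "\<dots> \<le> (\<Sum>S\<in>Pow (Basis::'a set). ennreal ((1/2) ^ ?d) * hausdorff_content ?d (2 * \<delta>) ?Q)"
    using hausdorff_content_affine_le[of "1/2" ?d "2 * \<delta>" _ ?Q] by (intro sum_mono) simp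
  also have "\<dots> = ennreal (2 ^ ?d * (1/2) ^ ?d) * hausdorff_content ?d (2 * \<delta>) ?Q"
    by (simp add: card_Pow mult.assoc ennreal_mult flip: ennreal_power ennreal_numeral)
  also have "\<dots> = hausdorff_content ?d (2 * \<delta>) ?Q"
    by (simp flip: power_mult_distrib)
  finally show ?thesis .
qed

text \<open>Doubling \<delta> does not lower the content of the cube. So \<delta> may be doubled
  until the cube is an admissible cover of itself, and its own weight bounds the content at every
  scale.\<close>

lemma hausdorff_outer_unit_cube:
  "hausdorff_outer DIM('a) (cbox 0 One :: 'a::euclidean_space set) < top"
proof -
  let ?Q = "cbox 0 One :: 'a set" and ?d = "DIM('a)"
  have "hausdorff_content ?d \<delta> ?Q \<le> hausdorff_weight ?d ?Q" if "0 < \<delta>" for \<delta>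
  proof -
    have *: "hausdorff_content ?d \<delta> ?Q \<le> hausdorff_content ?d (2 ^ n * \<delta>) ?Q" for n
    proof (induction n)
      case (Suc n)
      show ?case
        using Suc hausdorff_content_unit_cube_double[where 'a='a, of "2 ^ n * \<delta>"] that
        by (simp add: mult.assoc)
    qed simp
    obtain n where "diameter ?Q / \<delta> < 2 ^ n" using real_arch_pow[of 2 "diameter ?Q / \<delta>"] by auto
    then have "diameter ?Q \<le> 2 ^ n * \<delta>" using that by (simp add: field_simps)
    then have "(\<lambda>i. if i = 0 then ?Q else {}) \<in> hausdorff_covers (2 ^ n * \<delta>) ?Q"
      using that by (auto simp: hausdorff_covers_def)
    then have "hausdorff_content ?d (2 ^ n * \<delta>) ?Q
        \<le> (\<Sum>i. hausdorff_weight ?d (if i = (0::nat) then ?Q else {}))"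
      unfolding hausdorff_content_def by (rule INF_lower)
    also have "\<dots> = (\<Sum>i\<in>{0::nat}. hausdorff_weight ?d (if i = (0::nat) then ?Q else {}))"
      by (rule suminf_finite) (auto simp: hausdorff_weight_def)
    finally show ?thesis using *[of n] by simp
  qed
  then have "hausdorff_outer ?d ?Q \<le> hausdorff_weight ?d ?Q"
    unfolding hausdorff_outer_def by (intro SUP_least) auto
  also have "\<dots> < top" by (simp add: hausdorff_weight_def)
  finally show ?thesis .
qed

lemma emeasure_vol_bounded:
  fixes A :: "'a::euclidean_space set"
  assumes "A \<in> sets vol" "bounded A"
  shows "emeasure vol A < top"
proof -
  obtain R where R: "0 < R" "\<And>x. x \<in> A \<Longrightarrow> norm x \<le> R"
    using assms(2) by (auto simp: bounded_pos)
  let ?g = "\<lambda>x. - R *\<^sub>R One + (2 * R) *\<^sub>R x :: 'a"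
  have "A \<subseteq> ?g ` cbox 0 One"
  proof
    fix x assume "x \<in> A"
    define y where "y = (1 / (2 * R)) *\<^sub>R (x + R *\<^sub>R One)"
    have "0 \<le> y \<bullet> b \<and> y \<bullet> b \<le> 1" if "b \<in> Basis" for b
      using Basis_le_norm[OF that, of x] R(1) R(2)[OF \<open>x \<in> A\<close>] that
      by (auto simp: y_def inner_add_left field_simps)
    then have "y \<in> cbox 0 One" by (auto simp: mem_box)
    moreover have "x = ?g y" using R(1) by (simp add: y_def)
    ultimately show "x \<in> ?g ` cbox 0 One" by blast
  qed
  then have "hausdorff_outer DIM('a) A \<le> ennreal ((2 * R) ^ DIM('a)) * hausdorff_outer DIM('a) (cbox 0 One :: 'a set)"
    using hausdorff_outer_mono hausdorff_outer_affine[of "2 * R" "DIM('a)" "- R *\<^sub>R One" "cbox 0 One"] R(1)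
    by (metis mult_pos_pos zero_less_numeral)
  also have "\<dots> < top" using hausdorff_outer_unit_cube[where 'a='a] by (simp add: ennreal_mult_less_top)
  finally show ?thesis using assms by (simp add: emeasure_vol)
qed

lemma emeasure_vol_ball:
  fixes x :: "'a::euclidean_space"
  assumes "0 < r"
  shows "emeasure vol (ball x r) = ennreal (r ^ DIM('a)) * emeasure vol (ball (0::'a) 1)"
proof -
  have "ball x r = (\<lambda>y. x + r *\<^sub>R y) ` ball 0 1"
  proof (intro equalityI subsetI)
    fix y assume y: "y \<in> ball x r"
    then have "y = x + r *\<^sub>R ((1 / r) *\<^sub>R (y - x))" "(1 / r) *\<^sub>R (y - x) \<in> ball 0 1"
      using assms by (auto simp: dist_norm norm_minus_commute)
    then show "y \<in> (\<lambda>y. x + r *\<^sub>R y) ` ball 0 1" by blast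
  qed (use assms in \<open>auto simp: dist_norm\<close>)
  then show ?thesis using assms by (simp add: emeasure_vol_affine)
qed

text \<open>If the unit ball were null, scaling would make all balls null and hence the whole space.
  That the space is not null will follow from the existence of a region of volume V > 0.\<close>

lemma emeasure_vol_ball_pos:
  fixes x :: "'a::euclidean_space"
  assumes "emeasure (vol :: 'a measure) UNIV \<noteq> 0" "0 < r"
  shows "0 < emeasure vol (ball x r)"
proof -
  have "emeasure vol (ball (0::'a) 1) \<noteq> 0"
  proof
    assume 0: "emeasure vol (ball (0::'a) 1) = 0"
    have "emeasure vol (ball (0::'a) (real (Suc n))) = 0" for n
      by (subst emeasure_vol_ball) (simp_all only: 0, simp_all)
    then have "emeasure vol (\<Union>n. ball (0::'a) (real (Suc n))) = 0"
      by (intro emeasure_UN_eq_0) auto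
    moreover have "(\<Union>n. ball (0::'a) (real (Suc n))) = UNIV"
    proof (intro equalityI subsetI)
      fix x :: 'a
      obtain n where "norm x < real n" using reals_Archimedean2 by blast
      then have "x \<in> ball 0 (real (Suc n))" by simp
      then show "x \<in> (\<Union>n. ball 0 (real (Suc n)))" by blast
    qed simp
    ultimately show False using assms by simp
  qed
  then show ?thesis
    unfolding emeasure_vol_ball[OF assms(2), of x] using assms(2)
    by (simp add: zero_less_iff_neq_zero)
qed

section \<open>Smooth functions and a smooth step\<close>

lemma Ck_on_cong:
  assumes "open S" "\<And>x. x \<in> S \<Longrightarrow> f x = g x" "Ck_on k f S"
  shows "Ck_on k g S"
  using assms(2,3)
proof (induction k arbitrary: f g)
  case 0
  then show ?case using continuous_on_cong[of S S f g] by simp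
next
  case (Suc k)
  have g: "(g has_derivative frechet_derivative f (at x)) (at x)" if "x \<in> S" for x
    using Suc.prems that assms(1)
    by (intro has_derivative_transform_within_open[of f _ x UNIV S g])
      (auto simp: frechet_derivative_works)
  have "Ck_on k (\<lambda>x. frechet_derivative g (at x) v) S" for v
  proof (rule Suc.IH)
    show "frechet_derivative f (at x) v = frechet_derivative g (at x) v" if "x \<in> S" for x
      by (rule fun_cong[OF frechet_derivative_at[OF g[OF that]]])
    show "Ck_on k (\<lambda>x. frechet_derivative f (at x) v) S"
      using Suc.prems(2) by simp
  qed
  then show ?case using g by (auto simp: differentiable_def)
qed

text \<open>Allows any explicit derivative \<open>D\<close> in place of
  \<open>frechet_derivative\<close>, so that the closure properties below become inductions over the
  usual differentiation rules.\<close>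

lemma Ck_on_SucI_open:
  assumes "open S" "\<And>x. x \<in> S \<Longrightarrow> (f has_derivative D x) (at x)" "\<And>v. Ck_on k (\<lambda>x. D x v) S"
  shows "Ck_on (Suc k) f S"
proof -
  have "Ck_on k (\<lambda>x. frechet_derivative f (at x) v) S" for v
  proof (rule Ck_on_cong[OF assms(1) _ assms(3)[of v]])
    show "D x v = frechet_derivative f (at x) v" if "x \<in> S" for x
      by (rule fun_cong[OF frechet_derivative_at[OF assms(2)[OF that]]])
  qed
  then show ?thesis using assms(2) by (auto simp: differentiable_def)
qed

lemma Ck_on_Suc_has_derivative:
  "Ck_on (Suc k) f S \<Longrightarrow> x \<in> S \<Longrightarrow> (f has_derivative frechet_derivative f (at x)) (at x)"
  by (auto simp: frechet_derivative_works)

lemma Ck_on_imp_continuous_on: "Ck_on k f S \<Longrightarrow> continuous_on S f"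
  by (cases k) (auto intro!: continuous_at_imp_continuous_on differentiable_imp_continuous_within)

lemma Ck_on_Suc_imp: "Ck_on (Suc k) f S \<Longrightarrow> Ck_on k f S"
proof (induction k arbitrary: f)
  case 0
  then show ?case using Ck_on_imp_continuous_on by (metis Ck_on.simps(1))
qed auto

lemma Ck_on_subset: "Ck_on k f S \<Longrightarrow> T \<subseteq> S \<Longrightarrow> Ck_on k f T"
  by (induction k arbitrary: f) (auto intro: continuous_on_subset)

lemma Ck_on_const [simp]: "Ck_on k (\<lambda>_. c) S"
  by (induction k arbitrary: c) auto

lemma Ck_on_bounded_linear: "bounded_linear f \<Longrightarrow> Ck_on k f S"
proof (cases k)
  case (Suc n)
  assume f: "bounded_linear f"
  have "frechet_derivative f (at x) = f" for x
    using frechet_derivative_at[OF bounded_linear_imp_has_derivative[OF f]] by metis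
  then show ?thesis using Suc f bounded_linear_imp_differentiable by auto
qed (auto intro: linear_continuous_on)

lemma Ck_on_add:
  assumes "open S"
  shows "Ck_on k f S \<Longrightarrow> Ck_on k g S \<Longrightarrow> Ck_on k (\<lambda>x. f x + g x) S"
proof (induction k arbitrary: f g)
  case (Suc k)
  show ?case
  proof (rule Ck_on_SucI_open[OF assms])
    show "((\<lambda>x. f x + g x) has_derivative
        (\<lambda>v. frechet_derivative f (at x) v + frechet_derivative g (at x) v)) (at x)" if "x \<in> S" for x
      by (intro has_derivative_add Ck_on_Suc_has_derivative[OF Suc.prems(1) that]
          Ck_on_Suc_has_derivative[OF Suc.prems(2) that])
  qed (use Suc in auto)
qed (auto intro: continuous_on_add)

lemma Ck_on_scaleR:
  fixes f :: "'a::real_normed_vector \<Rightarrow> real"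
  assumes "open S"
  shows "Ck_on k f S \<Longrightarrow> Ck_on k g S \<Longrightarrow> Ck_on k (\<lambda>x. f x *\<^sub>R g x) S"
proof (induction k arbitrary: f g)
  case (Suc k)
  show ?case
  proof (rule Ck_on_SucI_open[OF assms])
    show "((\<lambda>x. f x *\<^sub>R g x) has_derivative
        (\<lambda>v. f x *\<^sub>R frechet_derivative g (at x) v + frechet_derivative f (at x) v *\<^sub>R g x)) (at x)"
      if "x \<in> S" for x
      by (intro has_derivative_scaleR Ck_on_Suc_has_derivative[OF Suc.prems(1) that]
          Ck_on_Suc_has_derivative[OF Suc.prems(2) that])
    show "Ck_on k (\<lambda>x. f x *\<^sub>R frechet_derivative g (at x) v + frechet_derivative f (at x) v *\<^sub>R g x) S" for v
      using Suc.prems Ck_on_Suc_imp[OF Suc.prems(1)] Ck_on_Suc_imp[OF Suc.prems(2)]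
      by (intro Ck_on_add assms Suc.IH) auto
  qed
qed (auto intro: continuous_on_scaleR)

text \<open>With a real inner function \<open>q\<close> the derivative of \<open>g\<close> at
  \<open>q x\<close> is determined by its value at 1. The chain rule is then a product of a real
  function and a vector function, to which \<open>Ck_on_scaleR\<close> and the induction hypothesis
  apply.\<close>

lemma Ck_on_compose_real:
  fixes g :: "real \<Rightarrow> 'b::real_normed_vector"
  assumes "open S" "q ` S \<subseteq> T"
  shows "Ck_on k g T \<Longrightarrow> Ck_on k q S \<Longrightarrow> Ck_on k (\<lambda>x. g (q x)) S"
proof (induction k arbitrary: g)
  case 0
  then show ?case using assms by (auto intro: continuous_on_compose2)
next
  case (Suc k)
  note g = Ck_on_Suc_has_derivative[OF Suc.prems(1)]
  show ?case
  proof (rule Ck_on_SucI_open[OF assms(1)])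
    fix x assume x: "x \<in> S"
    then have "q x \<in> T" using assms by auto
    have lin: "frechet_derivative g (at (q x)) r = r *\<^sub>R frechet_derivative g (at (q x)) 1" for r
      using linear_scale[OF has_derivative_linear[OF g[OF \<open>q x \<in> T\<close>]], of r 1] by simp
    have "((\<lambda>x. g (q x)) has_derivative
        (\<lambda>v. frechet_derivative g (at (q x)) (frechet_derivative q (at x) v))) (at x)"
      by (rule has_derivative_compose[OF Ck_on_Suc_has_derivative[OF Suc.prems(2) x] g[OF \<open>q x \<in> T\<close>]])
    also have "(\<lambda>v. frechet_derivative g (at (q x)) (frechet_derivative q (at x) v))
        = (\<lambda>v. frechet_derivative q (at x) v *\<^sub>R frechet_derivative g (at (q x)) 1)"
      by (rule ext) (rule lin)
    finally show "((\<lambda>x. g (q x)) has_derivative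
        (\<lambda>v. frechet_derivative q (at x) v *\<^sub>R frechet_derivative g (at (q x)) 1)) (at x)" .
  next
    show "Ck_on k (\<lambda>x. frechet_derivative q (at x) v *\<^sub>R frechet_derivative g (at (q x)) 1) S" for v
      using Suc.prems Ck_on_Suc_imp[OF Suc.prems(2)]
      by (intro Ck_on_scaleR assms Suc.IH[where g = "\<lambda>y. frechet_derivative g (at y) 1"]) auto
  qed
qed

lemma Ck_on_affine:
  fixes f :: "'a::real_normed_vector \<Rightarrow> 'b::real_normed_vector"
  assumes "open S" "\<And>x. x \<in> S \<Longrightarrow> a + t *\<^sub>R x \<in> T"
  shows "Ck_on k f T \<Longrightarrow> Ck_on k (\<lambda>x. f (a + t *\<^sub>R x)) S"
proof (induction k arbitrary: f)
  case 0
  then show ?case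
    using assms by (auto intro!: continuous_on_compose2[of T f S] continuous_intros)
next
  case (Suc k)
  show ?case
  proof (rule Ck_on_SucI_open[OF assms(1)])
    fix x assume "x \<in> S"
    have "((\<lambda>x. a + t *\<^sub>R x) has_derivative (\<lambda>v. t *\<^sub>R v)) (at x)"
      by (auto intro!: derivative_eq_intros)
    then show "((\<lambda>x. f (a + t *\<^sub>R x)) has_derivative
        (\<lambda>v. frechet_derivative f (at (a + t *\<^sub>R x)) (t *\<^sub>R v))) (at x)"
      by (rule has_derivative_compose[where f = "\<lambda>x. a + t *\<^sub>R x" and g = f,
          OF _ Ck_on_Suc_has_derivative[OF Suc.prems assms(2)[OF \<open>x \<in> S\<close>]]])
  next
    show "Ck_on k (\<lambda>x. frechet_derivative f (at (a + t *\<^sub>R x)) (t *\<^sub>R v)) S" for v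
      using Suc.prems by (intro Suc.IH[where f = "\<lambda>y. frechet_derivative f (at y) (t *\<^sub>R v)"]) auto
  qed
qed

lemma Ck_on_Un:
  assumes "open S" "open T"
  shows "Ck_on k f S \<Longrightarrow> Ck_on k f T \<Longrightarrow> Ck_on k f (S \<union> T)"
  by (induction k arbitrary: f) (use assms continuous_on_open_Un in auto)

lemma smooth_on_imp_has_derivative:
  "smooth_on f S \<Longrightarrow> x \<in> S \<Longrightarrow> (f has_derivative frechet_derivative f (at x)) (at x)"
  unfolding smooth_on_def using Ck_on_Suc_has_derivative by blast

lemma smooth_on_imp_continuous_on_derivative:
  "smooth_on f S \<Longrightarrow> continuous_on S (\<lambda>x. frechet_derivative f (at x) v)"
  unfolding smooth_on_def by (metis Ck_on.simps)

lemma smooth_on_const [simp]: "smooth_on (\<lambda>_. c) S"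
  by (simp add: smooth_on_def)

lemma smooth_on_bounded_linear: "bounded_linear f \<Longrightarrow> smooth_on f S"
  by (simp add: smooth_on_def Ck_on_bounded_linear)

lemma smooth_on_add:
  "open S \<Longrightarrow> smooth_on f S \<Longrightarrow> smooth_on g S \<Longrightarrow> smooth_on (\<lambda>x. f x + g x) S"
  by (simp add: smooth_on_def Ck_on_add)

lemma smooth_on_scaleR:
  fixes f :: "'a::real_normed_vector \<Rightarrow> real"
  shows "open S \<Longrightarrow> smooth_on f S \<Longrightarrow> smooth_on g S \<Longrightarrow> smooth_on (\<lambda>x. f x *\<^sub>R g x) S"
  by (simp add: smooth_on_def Ck_on_scaleR)

lemma smooth_on_mult:
  fixes f g :: "'a::real_normed_vector \<Rightarrow> real"
  shows "open S \<Longrightarrow> smooth_on f S \<Longrightarrow> smooth_on g S \<Longrightarrow> smooth_on (\<lambda>x. f x * g x) S"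
  using smooth_on_scaleR[of S f g] by simp

lemma smooth_on_affine:
  assumes "open S" "\<And>x. x \<in> S \<Longrightarrow> a + t *\<^sub>R x \<in> T" "smooth_on f T"
  shows "smooth_on (\<lambda>x. f (a + t *\<^sub>R x)) S"
  using assms(3) Ck_on_affine[OF assms(1,2), where f = f] by (simp add: smooth_on_def)

lemma smooth_on_compose_real:
  fixes g :: "real \<Rightarrow> 'b::real_normed_vector"
  shows "open S \<Longrightarrow> q ` S \<subseteq> T \<Longrightarrow> smooth_on g T \<Longrightarrow> smooth_on q S \<Longrightarrow> smooth_on (\<lambda>x. g (q x)) S"
  by (simp add: smooth_on_def Ck_on_compose_real)

lemma smooth_on_subset: "smooth_on f S \<Longrightarrow> T \<subseteq> S \<Longrightarrow> smooth_on f T"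
  unfolding smooth_on_def using Ck_on_subset by blast

lemma smooth_on_cong:
  "open S \<Longrightarrow> (\<And>x. x \<in> S \<Longrightarrow> f x = g x) \<Longrightarrow> smooth_on f S \<Longrightarrow> smooth_on g S"
  unfolding smooth_on_def using Ck_on_cong by blast

lemma smooth_on_Un:
  "open S \<Longrightarrow> open T \<Longrightarrow> smooth_on f S \<Longrightarrow> smooth_on f T \<Longrightarrow> smooth_on f (S \<union> T)"
  by (simp add: smooth_on_def Ck_on_Un)

lemma smooth_on_inner_left: "smooth_on (\<lambda>x. x \<bullet> b) S"
  by (intro smooth_on_bounded_linear bounded_linear_inner_left)

lemma smooth_on_norm_square:
  "smooth_on (\<lambda>x::'a::euclidean_space. x \<bullet> x) UNIV"
proof -
  have "smooth_on (\<lambda>x::'a. \<Sum>b\<in>B. (x \<bullet> b) * (x \<bullet> b)) UNIV" if "finite B" for B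
    using that
    by induction (auto intro!: smooth_on_add smooth_on_mult smooth_on_inner_left)
  from this[of Basis] show ?thesis by (simp flip: euclidean_inner)
qed

section \<open>Smooth transition on the real line\<close>

lemma Ck_on_Suc_real:
  fixes g :: "real \<Rightarrow> real"
  assumes "open S" "\<And>x. x \<in> S \<Longrightarrow> (g has_real_derivative g' x) (at x)" "Ck_on k g' S"
  shows "Ck_on (Suc k) g S"
proof (rule Ck_on_SucI_open[OF assms(1)])
  show "(g has_derivative (\<lambda>v. v *\<^sub>R g' x)) (at x)" if "x \<in> S" for x
    using assms(2)[OF that] by (simp add: has_field_derivative_def mult_commute_abs)
  show "Ck_on k (\<lambda>x. v *\<^sub>R g' x) S" for v
    by (intro Ck_on_scaleR assms) simp
qed

lemma smooth_on_inverse_pos: "smooth_on (inverse :: real \<Rightarrow> real) {0<..}"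
proof -
  have "Ck_on k (inverse :: real \<Rightarrow> real) {0<..}" for k
  proof (induction k)
    case 0
    then show ?case by (auto intro!: continuous_intros)
  next
    case (Suc k)
    have "Ck_on k (\<lambda>x::real. (-1) *\<^sub>R (inverse x *\<^sub>R inverse x)) {0<..}"
      by (intro Ck_on_scaleR Suc) auto
    then show ?case
      by (intro Ck_on_Suc_real) (auto intro!: derivative_eq_intros)
  qed
  then show ?thesis by (simp add: smooth_on_def)
qed

text \<open>The classical flat function exp(-1/t), multiplied by powers of 1/t. With these powers
  the family is closed under differentiation up to linear combinations, so smoothness is one
  induction, for all n at once.\<close>

definition flat_exp :: "nat \<Rightarrow> real \<Rightarrow> real" where
  "flat_exp n t = (if t \<le> 0 then 0 else (1 / t) ^ n * exp (- (1 / t)))"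

lemma has_derivative_flat_exp:
  "(flat_exp n has_real_derivative (flat_exp (n + 2) t - real n * flat_exp (n + 1) t)) (at t)"
proof -
  consider "t < 0" | "t = 0" | "0 < t" by linarith
  then show ?thesis
  proof cases
    case 1
    have "((\<lambda>_. 0) has_real_derivative 0) (at t)" by simp
    then have "(flat_exp n has_real_derivative 0) (at t)"
      by (rule has_field_derivative_transform_within_open[of _ _ _ "{..<0}"])
        (use 1 in \<open>auto simp: flat_exp_def\<close>)
    then show ?thesis using 1 by (simp add: flat_exp_def)
  next
    case 2
    \<comment> \<open>At 0 the difference quotient vanishes from the left and is (1/h)^(n+1)
      exp(-1/h) from the right, where the exponential beats the power.\<close>
    have "((\<lambda>h. (flat_exp n (0 + h) - flat_exp n 0) / h) \<longlongrightarrow> 0) (at 0)"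
    proof (rule filterlim_split_at)
      have "eventually (\<lambda>h. (flat_exp n (0 + h) - flat_exp n 0) / h = 0) (at_left (0::real))"
        by (auto simp: eventually_at_filter flat_exp_def)
      then show "((\<lambda>h. (flat_exp n (0 + h) - flat_exp n 0) / h) \<longlongrightarrow> 0) (at_left 0)"
        by (rule tendsto_eventually)
      have "filterlim (\<lambda>h::real. 1 / h) at_top (at_right 0)"
        using filterlim_inverse_at_top_right by (simp add: inverse_eq_divide)
      from filterlim_compose[OF tendsto_power_div_exp_0[of "Suc n"] this]
      have "((\<lambda>h::real. (1 / h) ^ Suc n / exp (1 / h)) \<longlongrightarrow> 0) (at_right 0)" .
      moreover have "eventually (\<lambda>h. (1 / h) ^ Suc n / exp (1 / h) = (flat_exp n (0 + h) - flat_exp n 0) / h)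
          (at_right (0::real))"
        by (auto simp: eventually_at_filter flat_exp_def exp_minus field_simps)
      ultimately show "((\<lambda>h. (flat_exp n (0 + h) - flat_exp n 0) / h) \<longlongrightarrow> 0) (at_right 0)"
        by (rule Lim_transform_eventually)
    qed
    then show ?thesis using 2 by (simp add: DERIV_def flat_exp_def)
  next
    case 3
    have inv: "((\<lambda>t. 1 / t) has_real_derivative - ((1 / t) * (1 / t))) (at t)"
      using 3 by (auto intro!: derivative_eq_intros)
    have "((\<lambda>t. (1 / t) ^ n) has_real_derivative - real n * (1 / t) ^ (n + 1)) (at t)"
    proof (induction n)
      case (Suc n)
      have "((\<lambda>t. (1 / t) * (1 / t) ^ n) has_real_derivative - real (Suc n) * (1 / t) ^ (Suc n + 1)) (at t)"
        by (rule DERIV_cong[OF DERIV_mult[OF inv Suc]]) (simp add: algebra_simps add_divide_distrib diff_divide_distrib)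
      then show ?case by simp
    qed simp
    from DERIV_mult[OF this DERIV_fun_exp[OF DERIV_minus[OF inv]]]
    have "((\<lambda>t. (1 / t) ^ n * exp (- (1 / t))) has_real_derivative
        (flat_exp (n + 2) t - real n * flat_exp (n + 1) t)) (at t)"
      using 3 by (simp add: flat_exp_def algebra_simps)
    then show ?thesis
      by (rule has_field_derivative_transform_within_open[of _ _ _ "{0<..}"])
        (use 3 in \<open>auto simp: flat_exp_def\<close>)
  qed
qed

lemma smooth_on_flat_exp: "smooth_on (flat_exp n) UNIV"
proof -
  have "Ck_on k (flat_exp n) UNIV" for k n
  proof (induction k arbitrary: n)
    case 0
    show ?case
      using has_derivative_flat_exp by (auto intro!: continuous_at_imp_continuous_on DERIV_isCont)
  next
    case (Suc k)
    have "Ck_on k (\<lambda>t. flat_exp (n + 2) t + (- real n) *\<^sub>R flat_exp (n + 1) t) UNIV"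
      by (intro Ck_on_add Ck_on_scaleR Suc) auto
    then show ?case
      using has_derivative_flat_exp by (intro Ck_on_Suc_real) auto
  qed
  then show ?thesis by (simp add: smooth_on_def)
qed

text \<open>The usual quotient of flat functions, rising from 0 on t \<le> 0 to 1 on t \<ge> 1. The
  denominator is positive because t and 1 - t are never both \<le> 0.\<close>

definition smooth_step :: "real \<Rightarrow> real" where
  "smooth_step t = flat_exp 0 t * inverse (flat_exp 0 t + flat_exp 0 (1 - t))"

lemma flat_exp_0_pos: "0 < t \<Longrightarrow> 0 < flat_exp 0 t" and flat_exp_nonneg: "0 \<le> flat_exp 0 t"
  by (auto simp: flat_exp_def)

lemma smooth_step_denominator: "0 < flat_exp 0 t + flat_exp 0 (1 - t)"
proof (cases "0 < t")
  case True
  then show ?thesis using flat_exp_0_pos[of t] flat_exp_nonneg[of "1 - t"] by linarith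
next
  case False
  then show ?thesis using flat_exp_0_pos[of "1 - t"] flat_exp_nonneg[of t] by linarith
qed

lemma smooth_on_smooth_step: "smooth_on smooth_step UNIV"
proof -
  have "smooth_on (\<lambda>t. flat_exp 0 (1 + (-1) *\<^sub>R t)) UNIV"
    by (rule smooth_on_affine[of _ _ _ UNIV]) (auto simp: smooth_on_flat_exp)
  then have den: "smooth_on (\<lambda>t. flat_exp 0 t + flat_exp 0 (1 - t)) UNIV"
    by (intro smooth_on_add smooth_on_flat_exp) auto
  have "smooth_on (\<lambda>t. inverse (flat_exp 0 t + flat_exp 0 (1 - t))) UNIV"
    by (rule smooth_on_compose_real[OF _ _ smooth_on_inverse_pos den])
      (auto simp: smooth_step_denominator)
  then show ?thesis
    unfolding smooth_step_def[abs_def] by (intro smooth_on_mult smooth_on_flat_exp) auto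
qed

lemma smooth_step_le_0 [simp]: "t \<le> 0 \<Longrightarrow> smooth_step t = 0"
  by (simp add: smooth_step_def flat_exp_def)

lemma smooth_step_ge_1 [simp]: "1 \<le> t \<Longrightarrow> smooth_step t = 1"
  by (simp add: smooth_step_def flat_exp_def)

lemma smooth_step_nonneg: "0 \<le> smooth_step t" and smooth_step_le_1: "smooth_step t \<le> 1"
proof -
  have "0 \<le> flat_exp 0 t" "0 \<le> flat_exp 0 (1 - t)" by (auto simp: flat_exp_nonneg)
  then show "0 \<le> smooth_step t" "smooth_step t \<le> 1"
    using smooth_step_denominator[of t] by (auto simp: smooth_step_def field_simps)
qed

lemma smooth_step_has_derivative:
  "(smooth_step has_real_derivative frechet_derivative smooth_step (at t) 1) (at t)"
  (is "(_ has_real_derivative ?D 1) _")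
proof -
  have d: "(smooth_step has_derivative ?D) (at t)"
    by (rule smooth_on_imp_has_derivative[OF smooth_on_smooth_step]) simp
  have "?D v = ?D 1 * v" for v
    using linear_scale[OF has_derivative_linear[OF d], of v 1] by simp
  then have eq: "?D = (*) (?D 1)" by (rule ext)
  show ?thesis
    unfolding has_field_derivative_def
    by (rule arg_cong[where f = "\<lambda>D. (smooth_step has_derivative D) (at t)", OF eq, THEN iffD1, OF d])
qed

text \<open>At these points the step attains its minimum 0 or its maximum 1. This treats the end
  points 0 and 1 together with the constant parts.\<close>

lemma smooth_step_derivative_zero:
  assumes "t \<le> 0 \<or> 1 \<le> t"
  shows "frechet_derivative smooth_step (at t) 1 = 0"
proof (cases "t \<le> 0")
  case True
  then show ?thesis
    using DERIV_local_min[OF smooth_step_has_derivative, of 1 t] smooth_step_nonneg by simp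
next
  case False
  then show ?thesis
    using DERIV_local_max[OF smooth_step_has_derivative, of 1 t] smooth_step_le_1 assms by simp
qed

text \<open>A bound for the slope whose numerical value is immaterial. Fixing one makes it available
  as a constant in the cutting estimate and in \<open>rate\<close>, where it is divided by and must
  be positive.\<close>

definition step_slope :: real where
  "step_slope = (SOME K. 0 < K \<and> (\<forall>t. \<bar>frechet_derivative smooth_step (at t) 1\<bar> \<le> K))"

lemma step_slope_pos: "0 < step_slope"
  and smooth_step_derivative_le: "\<bar>frechet_derivative smooth_step (at t) 1\<bar> \<le> step_slope"
proof -
  let ?D = "\<lambda>t. frechet_derivative smooth_step (at t) 1"
  have "compact (?D ` {0..1})"
    using smooth_on_imp_continuous_on_derivative[OF smooth_on_smooth_step, of 1]
    by (intro compact_continuous_image) (auto intro: continuous_on_subset)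
  then obtain K where K: "0 < K" "\<And>t. t \<in> {0..1} \<Longrightarrow> \<bar>?D t\<bar> \<le> K"
    using compact_imp_bounded[of "?D ` {0..1}"] by (auto simp: bounded_pos)
  have "\<bar>?D t\<bar> \<le> K" for t
    using K smooth_step_derivative_zero[of t] by (cases "t \<in> {0..1}") auto
  then have "\<exists>K. 0 < K \<and> (\<forall>t. \<bar>?D t\<bar> \<le> K)" using K(1) by blast
  from someI_ex[OF this, folded step_slope_def]
  show "0 < step_slope" "\<bar>?D t\<bar> \<le> step_slope" by auto
qed

section \<open>Test fields and the divergence theorem\<close>

lemma test_field_outside: "x \<notin> closure {x. Y x \<noteq> 0} \<Longrightarrow> Y x = 0"
  using closure_subset[of "{x. Y x \<noteq> 0}"] by auto

lemma frechet_derivative_outside: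
  assumes "x \<notin> closure {x. Y x \<noteq> 0}"
  shows "frechet_derivative Y (at x) v = 0"
proof -
  have "((\<lambda>_. 0) has_derivative (\<lambda>_. 0)) (at x)" by simp
  then have "(Y has_derivative (\<lambda>_. 0)) (at x)"
  proof (rule has_derivative_transform_within_open)
    show "0 = Y y" if "y \<in> - closure {x. Y x \<noteq> 0}" for y
      by (rule test_field_outside[symmetric]) (use that in blast)
  qed (use assms in \<open>auto intro: open_Compl\<close>)
  then show ?thesis by (simp add: frechet_derivative_at[symmetric])
qed

text \<open>\<open>M\<close> and the complement of the closed support are open, cover the space, and
  the field is smooth on each. From here on, fields are handled on the whole space.\<close>

lemma smooth_on_UNIV_test_field:
  assumes "open M" "Y \<in> test_fields M"
  shows "smooth_on Y UNIV"
proof -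
  let ?N = "- closure {x. Y x \<noteq> 0}"
  have "smooth_on Y ?N"
  proof (rule smooth_on_cong)
    show "0 = Y x" if "x \<in> ?N" for x
      by (rule test_field_outside[symmetric]) (use that in blast)
  qed (auto intro: open_Compl)
  moreover have Y: "smooth_on Y M" "closure {x. Y x \<noteq> 0} \<subseteq> M"
    using assms(2) by (auto simp: test_fields_def)
  ultimately have "smooth_on Y (M \<union> ?N)"
    by (intro smooth_on_Un assms(1) open_Compl closed_closure)
  moreover have "M \<union> ?N = UNIV" using Y(2) by blast
  ultimately show ?thesis by simp
qed

lemma test_fieldI:
  assumes "smooth_on Y UNIV" "compact K" "K \<subseteq> M" "\<And>x. x \<notin> K \<Longrightarrow> Y x = 0" "\<And>x. norm (Y x) \<le> 1"
  shows "Y \<in> test_fields M"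
proof -
  have "closure {x. Y x \<noteq> 0} \<subseteq> K"
    using assms(2,4) by (intro closure_minimal) (auto intro: compact_imp_closed)
  moreover from this have "compact (closure {x. Y x \<noteq> 0})"
    using compact_Int_closed[OF assms(2), of "closure {x. Y x \<noteq> 0}"] by (simp add: Int_absorb1)
  ultimately show ?thesis
    using assms smooth_on_subset[OF assms(1)] by (auto simp: test_fields_def)
qed

lemma zero_in_test_fields: "(\<lambda>_. 0) \<in> test_fields M"
  by (rule test_fieldI[of _ "{}"]) auto

lemma divergence_eq:
  assumes "(Y has_derivative D) (at x)"
  shows "divergence Y x = (\<Sum>b\<in>Basis. D b \<bullet> b)"
  unfolding divergence_def frechet_derivative_at[OF assms, symmetric] ..

lemma divergence_zero [simp]: "divergence (\<lambda>_. 0) x = 0"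
  by (simp add: divergence_def)

text \<open>The algebra behind the product rule for the divergence: the gradient term of a scalar
  function times a field \<open>y\<close> collapses to the derivative in direction
  \<open>y\<close>.\<close>

lemma linear_sum_Basis:
  fixes D :: "'a::euclidean_space \<Rightarrow> real"
  assumes "linear D"
  shows "(\<Sum>b\<in>Basis. D b * (y \<bullet> b)) = D y"
proof -
  have "D y = D (\<Sum>b\<in>Basis. (y \<bullet> b) *\<^sub>R b)" by (simp add: euclidean_representation)
  also have "\<dots> = (\<Sum>b\<in>Basis. (y \<bullet> b) *\<^sub>R D b)"
    using assms by (simp add: linear_sum linear_scale)
  finally show ?thesis by (simp add: mult.commute)
qed

lemma continuous_on_divergence:
  "smooth_on Y UNIV \<Longrightarrow> continuous_on UNIV (divergence Y)"
  unfolding divergence_def[abs_def]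
  by (intro continuous_intros smooth_on_imp_continuous_on_derivative)

lemma divergence_outside: "x \<notin> closure {x. Y x \<noteq> 0} \<Longrightarrow> divergence Y x = 0"
  by (simp add: divergence_def frechet_derivative_outside)

lemma bounded_compact_support:
  fixes f :: "'a::euclidean_space \<Rightarrow> real"
  assumes "continuous_on UNIV f" "compact K" "\<And>x. x \<notin> K \<Longrightarrow> f x = 0"
  obtains B where "0 < B" "\<And>x. \<bar>f x\<bar> \<le> B"
proof -
  have "compact (f ` K)" using assms by (intro compact_continuous_image) (auto intro: continuous_on_subset)
  then obtain B where B: "0 < B" "\<And>x. x \<in> K \<Longrightarrow> \<bar>f x\<bar> \<le> B"
    using compact_imp_bounded[of "f ` K"] by (auto simp: bounded_pos)
  then have "\<bar>f x\<bar> \<le> B" for x using assms(3)[of x] by (cases "x \<in> K") auto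
  then show ?thesis using B(1) that by blast
qed

lemma integrable_vol_bounded:
  fixes f :: "'a::euclidean_space \<Rightarrow> real"
  assumes "f \<in> borel_measurable vol" "bounded K" "K \<in> sets vol" "\<And>x. \<bar>f x\<bar> \<le> B" "\<And>x. x \<notin> K \<Longrightarrow> f x = 0"
  shows "integrable vol f"
  by (rule integrableI_bounded_set[of K]) (use assms emeasure_vol_bounded[of K] in auto)

lemma integrable_vol_compact_support:
  fixes f :: "'a::euclidean_space \<Rightarrow> real"
  assumes "continuous_on UNIV f" "compact K" "\<And>x. x \<notin> K \<Longrightarrow> f x = 0"
  shows "integrable vol f"
proof -
  obtain B where "\<And>x. \<bar>f x\<bar> \<le> B" using bounded_compact_support[OF assms] by blast
  then show ?thesis
    using assms by (intro integrable_vol_bounded[of f K B])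
      (auto intro: borel_measurable_vol borel_measurable_continuous_onI compact_imp_bounded
        borel_sets_vol[OF borel_compact])
qed

lemma test_field_divergence_facts:
  assumes "open M" "Y \<in> test_fields M"
  shows "integrable vol (divergence Y)" and "\<exists>B>0. \<forall>x. \<bar>divergence Y x\<bar> \<le> B"
proof -
  have *: "continuous_on UNIV (divergence Y)" "compact (closure {x. Y x \<noteq> 0})"
    using continuous_on_divergence[OF smooth_on_UNIV_test_field[OF assms]] assms
    by (auto simp: test_fields_def)
  show "integrable vol (divergence Y)"
    by (rule integrable_vol_compact_support[OF * divergence_outside])
  show "\<exists>B>0. \<forall>x. \<bar>divergence Y x\<bar> \<le> B"
    by (rule bounded_compact_support[OF * divergence_outside]) auto
qed

section \<open>Differentiating integrals of translates\<close>

lemma set_integrable_vol: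
  "integrable vol f \<Longrightarrow> E \<in> sets vol \<Longrightarrow> set_integrable vol E f"
  for f :: "'a::euclidean_space \<Rightarrow> real"
  unfolding set_integrable_def by (rule integrable_mult_indicator)

text \<open>Dominated convergence: the difference quotients are bounded by the maximum of the
  directional derivative and vanish outside a fixed ball. Used with E = UNIV for the divergence
  theorem and with E = \<Omega> for moving a bump along a ray.\<close>

lemma has_derivative_integral_translate:
  fixes f :: "'a::euclidean_space \<Rightarrow> real"
  assumes f: "smooth_on f UNIV" and K: "compact K" "\<And>x. x \<notin> K \<Longrightarrow> f x = 0" and E: "E \<in> sets vol"
  shows "((\<lambda>h. LINT x:E|vol. f (x + h *\<^sub>R a)) has_real_derivative
    (LINT x:E|vol. frechet_derivative f (at x) a)) (at 0)"
proof -
  let ?f' = "\<lambda>x. frechet_derivative f (at x) a"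
  let ?F = "\<lambda>h. LINT x:E|vol. f (x + h *\<^sub>R a)"
  have contf: "continuous_on UNIV f"
    using f Ck_on_imp_continuous_on unfolding smooth_on_def by blast
  have contf': "continuous_on UNIV ?f'" by (rule smooth_on_imp_continuous_on_derivative[OF f])
  have "closure {x. f x \<noteq> 0} \<subseteq> K"
    using K by (intro closure_minimal) (auto intro: compact_imp_closed)
  then have zero': "?f' x = 0" if "x \<notin> K" for x
    using that by (intro frechet_derivative_outside) auto
  obtain L where L: "0 < L" "\<And>x. \<bar>?f' x\<bar> \<le> L"
    using bounded_compact_support[OF contf' K(1) zero'] by blast
  obtain R where R: "\<And>x. x \<in> K \<Longrightarrow> norm x \<le> R"
    using compact_imp_bounded[OF K(1)] by (auto simp: bounded_iff)
  have line: "((\<lambda>h. f (x + h *\<^sub>R a)) has_real_derivative ?f' (x + h *\<^sub>R a)) (at h)" for x h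
  proof -
    have "((\<lambda>h. x + h *\<^sub>R a) has_derivative (\<lambda>k. k *\<^sub>R a)) (at h)"
      by (auto intro!: derivative_eq_intros)
    note has_derivative_compose[OF this smooth_on_imp_has_derivative[OF f UNIV_I]]
    moreover have "frechet_derivative f (at (x + h *\<^sub>R a)) (k *\<^sub>R a) = k *\<^sub>R ?f' (x + h *\<^sub>R a)" for k
      using linear_scale[OF has_derivative_linear[OF smooth_on_imp_has_derivative[OF f UNIV_I]]] by blast
    ultimately show ?thesis by (simp add: has_field_derivative_def mult_commute_abs)
  qed
  have quot: "\<bar>(f (x + h *\<^sub>R a) - f x) / h\<bar> \<le> L" if "h \<noteq> 0" for x h
  proof -
    have "norm (f (x + h *\<^sub>R a) - f (x + 0 *\<^sub>R a)) \<le> L * norm (h - 0)"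
      by (rule field_differentiable_bound[of UNIV _ "\<lambda>h. ?f' (x + h *\<^sub>R a)"])
        (use line L in auto)
    then show ?thesis using that by (simp add: field_simps)
  qed
  \<comment> \<open>Restricting to \<bar>h\<bar> < 1 keeps all translated supports inside the ball
    of radius \<open>R + norm a\<close>, which carries the dominating function. The limit at 0 is
    unaffected.\<close>
  have "((\<lambda>h. (?F h - ?F 0) / h) \<longlongrightarrow> (LINT x:E|vol. ?f' x)) (at 0 within {-1<..<1})"
    unfolding tendsto_at_iff_sequentially
  proof (intro allI impI)
    fix X :: "nat \<Rightarrow> real"
    assume X: "\<forall>i. X i \<in> {-1<..<1} - {0}" "X \<longlonglongrightarrow> 0"
    let ?q = "\<lambda>i x. (f (x + X i *\<^sub>R a) - f x) / X i"
    let ?C = "cball 0 (R + norm a) :: 'a set"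
    have q0: "?q i x = 0" if "x \<notin> ?C" for i x
    proof -
      have "\<bar>X i\<bar> * norm a \<le> 1 * norm a" using X(1) by (intro mult_right_mono) (auto simp: abs_le_iff less_imp_le)
      moreover have "norm x \<le> norm (x + X i *\<^sub>R a) + norm (X i *\<^sub>R a)"
        using norm_triangle_ineq4[of "x + X i *\<^sub>R a" "X i *\<^sub>R a"] by simp
      moreover have "\<not> norm x \<le> R + norm a" using that by simp
      ultimately have "\<not> norm (x + X i *\<^sub>R a) \<le> R" "\<not> norm x \<le> R" by (auto simp: not_le) (smt (verit) norm_ge_zero)
      then have "f (x + X i *\<^sub>R a) = 0" "f x = 0" using R K(2) by blast+
      then show ?thesis by simp
    qed
    have cont: "continuous_on UNIV (\<lambda>x. f (x + h *\<^sub>R a))" for h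
      by (intro continuous_on_compose2[OF contf] continuous_intros) auto
    have int: "integrable vol (\<lambda>x. f (x + h *\<^sub>R a))" for h
    proof (rule integrable_vol_compact_support[OF cont])
      show "compact ((\<lambda>x. x - h *\<^sub>R a) ` K)" by (intro compact_continuous_image continuous_intros K)
      show "f (x + h *\<^sub>R a) = 0" if "x \<notin> (\<lambda>x. x - h *\<^sub>R a) ` K" for x
        using that by (intro K) (force simp: image_iff)
    qed
    have eq: "(?F (X i) - ?F 0) / X i = (LINT x|vol. indicator E x *\<^sub>R ?q i x)" for i
    proof -
      have "?F (X i) - ?F 0 = (LINT x:E|vol. f (x + X i *\<^sub>R a) - f (x + 0 *\<^sub>R a))"
        by (rule set_integral_diff(2)[symmetric]; rule set_integrable_vol[OF int E])
      also have "\<dots> / X i = (LINT x:E|vol. (f (x + X i *\<^sub>R a) - f (x + 0 *\<^sub>R a)) / X i)" by simp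
      finally show ?thesis by (simp add: set_lebesgue_integral_def)
    qed
    have "(\<lambda>i. LINT x|vol. indicator E x *\<^sub>R ?q i x) \<longlonglongrightarrow> (LINT x|vol. indicator E x *\<^sub>R ?f' x)"
    proof (rule integral_dominated_convergence[where w = "\<lambda>x. L * indicator ?C x"])
      show "(\<lambda>x. indicator E x *\<^sub>R ?f' x) \<in> borel_measurable vol"
        using contf' E by (intro borel_measurable_scaleR borel_measurable_indicator borel_measurable_vol
            borel_measurable_continuous_onI) auto
      show "(\<lambda>x. indicator E x *\<^sub>R ?q i x) \<in> borel_measurable vol" for i
        using cont contf E by (intro borel_measurable_scaleR borel_measurable_indicator borel_measurable_vol
            borel_measurable_continuous_onI continuous_intros) (use X in auto)
      have "emeasure vol ?C < top" by (rule emeasure_vol_bounded) auto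
      then show "integrable vol (\<lambda>x. L * indicator ?C x)"
        by (intro integrable_mult_right) auto
      show "AE x in vol. norm (indicator E x *\<^sub>R ?q i x) \<le> L * indicator ?C x" for i
      proof (rule AE_I2)
        fix x
        show "norm (indicator E x *\<^sub>R ?q i x) \<le> L * indicator ?C x"
          using quot[of "X i" x] X(1) q0[of x i] L(1) by (cases "x \<in> ?C") (auto simp: indicator_def)
      qed
      show "AE x in vol. (\<lambda>i. indicator E x *\<^sub>R ?q i x) \<longlonglongrightarrow> indicator E x *\<^sub>R ?f' x"
      proof (rule AE_I2)
        fix x
        have "((\<lambda>h. (f (x + h *\<^sub>R a) - f x) / h) \<longlongrightarrow> ?f' x) (at 0)"
          using line[of x 0] by (simp add: has_field_derivative_iff)
        then have "(\<lambda>i. ?q i x) \<longlonglongrightarrow> ?f' x"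
          using X unfolding tendsto_at_iff_sequentially by (auto simp: comp_def)
        then show "(\<lambda>i. indicator E x *\<^sub>R ?q i x) \<longlonglongrightarrow> indicator E x *\<^sub>R ?f' x"
          by (intro tendsto_intros)
      qed
    qed
    then show "((\<lambda>h. (?F h - ?F 0) / h) \<circ> X) \<longlonglongrightarrow> (LINT x:E|vol. ?f' x)"
      unfolding comp_def eq by (simp add: set_lebesgue_integral_def)
  qed
  then show ?thesis by (simp add: has_field_derivative_iff at_within_open[of 0 "{-1<..<1}"])
qed

text \<open>By translation invariance the integral of a translate does not depend on the shift, so
  its derivative is 0. This takes the place of Fubini and the fundamental theorem of
  calculus.\<close>

lemma integral_directional_derivative_eq_0:
  fixes f :: "'a::euclidean_space \<Rightarrow> real"
  assumes f: "smooth_on f UNIV" and K: "compact K" "\<And>x. x \<notin> K \<Longrightarrow> f x = 0"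
  shows "(LINT x|vol. frechet_derivative f (at x) a) = 0"
proof -
  have "continuous_on UNIV f" using f Ck_on_imp_continuous_on unfolding smooth_on_def by blast
  then have "f \<in> borel_measurable vol" by (intro borel_measurable_vol borel_measurable_continuous_onI)
  then have "(LINT x:UNIV|vol. f (x + h *\<^sub>R a)) = (LINT x|vol. f x)" for h
    using integral_vol_affine[of f 1 "h *\<^sub>R a"] by (simp add: add.commute set_lebesgue_integral_def)
  then have "((\<lambda>_. LINT x|vol. f x) has_real_derivative (LINT x:UNIV|vol. frechet_derivative f (at x) a)) (at 0)"
    using has_derivative_integral_translate[OF f K, of UNIV a] by simp
  then show ?thesis
    using DERIV_unique[OF _ DERIV_const] by (fastforce simp: set_lebesgue_integral_def)
qed

text \<open>Each component contributes the integral of a directional derivative of a compactly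
  supported function. The consequence needed later is that \<open>M\<close> has no perimeter
  relative to itself.\<close>

lemma integral_divergence_eq_0:
  assumes "open M" "W \<in> test_fields M"
  shows "(LINT x:M|vol. divergence W x) = 0"
proof -
  have W: "smooth_on W UNIV" by (rule smooth_on_UNIV_test_field[OF assms])
  let ?K = "closure {x. W x \<noteq> 0}"
  have K: "compact ?K" "?K \<subseteq> M" using assms by (auto simp: test_fields_def)
  have der: "((\<lambda>x. W x \<bullet> b) has_derivative (\<lambda>v. frechet_derivative W (at x) v \<bullet> b)) (at x)" for x b
    by (intro has_derivative_inner_left smooth_on_imp_has_derivative[OF W UNIV_I])
  have smooth: "smooth_on (\<lambda>x. W x \<bullet> b) UNIV" for b
  proof -
    have "Ck_on k Y UNIV \<Longrightarrow> Ck_on k (\<lambda>x. Y x \<bullet> b) UNIV" for k and Y :: "'a \<Rightarrow> 'a"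
    proof (induction k arbitrary: Y)
      case 0
      then show ?case by (auto intro!: continuous_intros)
    next
      case (Suc k)
      show ?case
        by (rule Ck_on_SucI_open[OF _ has_derivative_inner_left[OF Ck_on_Suc_has_derivative[OF Suc.prems]]])
          (use Suc in auto)
    qed
    then show ?thesis using W by (simp add: smooth_on_def)
  qed
  have int: "integrable vol (\<lambda>x. frechet_derivative (\<lambda>x. W x \<bullet> b) (at x) b)" for b
  proof (rule integrable_vol_compact_support[OF smooth_on_imp_continuous_on_derivative[OF smooth] K(1)])
    fix x assume "x \<notin> ?K"
    then show "frechet_derivative (\<lambda>x. W x \<bullet> b) (at x) b = 0"
      unfolding frechet_derivative_at[OF der, symmetric] by (simp add: frechet_derivative_outside)
  qed
  have "(LINT x:M|vol. divergence W x) = (LINT x|vol. divergence W x)"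
    unfolding set_lebesgue_integral_def
    using K(2) divergence_outside[of _ W] by (intro Bochner_Integration.integral_cong) (auto simp: indicator_def)
  also have "\<dots> = (LINT x|vol. (\<Sum>b\<in>Basis. frechet_derivative (\<lambda>x. W x \<bullet> b) (at x) b))"
    unfolding divergence_def frechet_derivative_at[OF der, symmetric] ..
  also have "\<dots> = (\<Sum>b\<in>Basis. (LINT x|vol. frechet_derivative (\<lambda>x. W x \<bullet> b) (at x) b))"
    by (intro Bochner_Integration.integral_sum int)
  also have "\<dots> = 0"
    by (intro sum.neutral ballI integral_directional_derivative_eq_0[OF smooth K(1)])
      (subst test_field_outside, auto)
  finally show ?thesis .
qed

section \<open>Cutting by a ball and scaling\<close>

text \<open>The step is applied to an affine function of the squared norm, which unlike the norm is
  smooth at the origin. Since r^2 - (r - \<epsilon>)^2 \<ge> r \<epsilon>, the inner function has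
  slope at most 2 r / (r \<epsilon>) = 2 / \<epsilon> on the shell.\<close>

lemma radial_cutoff:
  assumes \<epsilon>: "0 < \<epsilon>" "\<epsilon> \<le> r"
  obtains \<phi> :: "'a::euclidean_space \<Rightarrow> real" where "smooth_on \<phi> UNIV"
    "\<And>x. 0 \<le> \<phi> x \<and> \<phi> x \<le> 1" "\<And>x. r \<le> norm x \<Longrightarrow> \<phi> x = 0" "\<And>x. norm x \<le> r - \<epsilon> \<Longrightarrow> \<phi> x = 1"
    "\<And>x v. \<bar>frechet_derivative \<phi> (at x) v\<bar>
      \<le> 2 * step_slope / \<epsilon> * norm v * indicator (ball 0 r - ball 0 (r - \<epsilon>)) x"
proof -
  define den where "den = r\<^sup>2 - (r - \<epsilon>)\<^sup>2"
  have "den = r * \<epsilon> + (r - \<epsilon>) * \<epsilon>" by (simp add: den_def power2_eq_square algebra_simps)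
  then have den: "r * \<epsilon> \<le> den" using \<epsilon> by simp
  moreover have "0 < r * \<epsilon>" using \<epsilon> by simp
  ultimately have den_pos: "0 < den" by linarith
  define g where "g x = (r\<^sup>2 - x \<bullet> x) / den" for x :: 'a
  define \<phi> where "\<phi> x = smooth_step (g x)" for x
  have g_le: "g x \<le> 0" if "r \<le> norm x" for x
  proof -
    have "r\<^sup>2 \<le> (norm x)\<^sup>2" using that \<epsilon> by (intro power_mono) auto
    then show ?thesis using den_pos by (simp add: g_def power2_norm_eq_inner divide_nonpos_pos)
  qed
  have g_ge: "1 \<le> g x" if "norm x \<le> r - \<epsilon>" for x
  proof -
    have "(norm x)\<^sup>2 \<le> (r - \<epsilon>)\<^sup>2" using that by (intro power_mono) auto
    then have "den \<le> r\<^sup>2 - x \<bullet> x" by (simp add: den_def power2_norm_eq_inner)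
    then show ?thesis using den_pos by (simp add: g_def)
  qed
  have den_ne: "den \<noteq> 0" using den_pos by simp
  have g_eq: "g x = r\<^sup>2 / den + (- (1 / den)) *\<^sub>R (x \<bullet> x)" for x
    using den_ne by (simp add: g_def diff_divide_distrib)
  have "smooth_on g UNIV"
    unfolding g_eq[abs_def] by (intro smooth_on_add smooth_on_scaleR smooth_on_norm_square) auto
  then have smooth: "smooth_on \<phi> UNIV"
    unfolding \<phi>_def[abs_def] by (intro smooth_on_compose_real[OF _ _ smooth_on_smooth_step]) auto
  have der: "(\<phi> has_derivative (\<lambda>v. frechet_derivative smooth_step (at (g x)) 1 * (- (2 * (x \<bullet> v)) / den))) (at x)" for x
  proof -
    have "(g has_derivative (\<lambda>v. - (2 * (x \<bullet> v)) / den)) (at x)"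
      unfolding g_def[abs_def] using den_ne by (auto intro!: derivative_eq_intros simp: inner_commute)
    from has_derivative_compose[OF this smooth_step_has_derivative[unfolded has_field_derivative_def]]
    show ?thesis by (simp add: \<phi>_def[abs_def])
  qed
  have "\<bar>frechet_derivative \<phi> (at x) v\<bar> \<le> 2 * step_slope / \<epsilon> * norm v * indicator (ball 0 r - ball 0 (r - \<epsilon>)) x" for x v
  proof (cases "x \<in> ball 0 r - ball 0 (r - \<epsilon>)")
    case False
    then have "g x \<le> 0 \<or> 1 \<le> g x" using g_le[of x] g_ge[of x] by (cases "norm x < r") auto
    then show ?thesis
      unfolding frechet_derivative_at[OF der, symmetric] using False
      by (simp add: smooth_step_derivative_zero)
  next
    case True
    have "\<bar>- (2 * (x \<bullet> v)) / den\<bar> = 2 * \<bar>x \<bullet> v\<bar> / den" using den_pos by (simp add: abs_mult)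
    also have "\<dots> \<le> 2 * (r * norm v) / (r * \<epsilon>)"
    proof (intro frac_le mult_left_mono)
      show "\<bar>x \<bullet> v\<bar> \<le> r * norm v"
        using Cauchy_Schwarz_ineq2[of x v] mult_right_mono[of "norm x" r "norm v"] True by simp
    qed (use \<epsilon> den in auto)
    also have "\<dots> = 2 * norm v / \<epsilon>" using \<epsilon> by simp
    finally have "\<bar>- (2 * (x \<bullet> v)) / den\<bar> \<le> 2 * norm v / \<epsilon>" .
    then have "\<bar>frechet_derivative smooth_step (at (g x)) 1 * (- (2 * (x \<bullet> v)) / den)\<bar> \<le> step_slope * (2 * norm v / \<epsilon>)"
      unfolding abs_mult using smooth_step_derivative_le step_slope_pos \<epsilon> by (intro mult_mono) auto
    then show ?thesis
      unfolding frechet_derivative_at[OF der, symmetric] using True by (simp add: mult.commute mult.left_commute)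
  qed
  then show ?thesis
    using smooth g_le g_ge smooth_step_nonneg smooth_step_le_1 by (intro that[of \<phi>]) (auto simp: \<phi>_def)
qed

text \<open>A convex combination keeps the norm at most 1. The only new term in the divergence comes
  from differentiating the weight, and it sees just the difference of the fields.\<close>

lemma test_field_blend:
  assumes "open M" "Y \<in> test_fields M" "Z \<in> test_fields M"
    and \<phi>: "smooth_on \<phi> UNIV" "\<And>x. 0 \<le> \<phi> x \<and> \<phi> x \<le> 1"
  defines "W \<equiv> \<lambda>x. \<phi> x *\<^sub>R Y x + (1 - \<phi> x) *\<^sub>R Z x"
  shows "W \<in> test_fields M"
    and "divergence W x = \<phi> x * divergence Y x + (1 - \<phi> x) * divergence Z x
      + frechet_derivative \<phi> (at x) (Y x - Z x)"
proof -
  note Y = smooth_on_UNIV_test_field[OF assms(1,2)] and Z = smooth_on_UNIV_test_field[OF assms(1,3)]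
  have eq: "1 - \<phi> x = 1 + (-1) *\<^sub>R \<phi> x" for x by simp
  show "W \<in> test_fields M"
  proof (rule test_fieldI)
    show "smooth_on W UNIV"
      unfolding W_def eq by (intro smooth_on_add smooth_on_scaleR Y Z \<phi>) auto
    show "compact (closure {x. Y x \<noteq> 0} \<union> closure {x. Z x \<noteq> 0})"
      "closure {x. Y x \<noteq> 0} \<union> closure {x. Z x \<noteq> 0} \<subseteq> M"
      using assms(2,3) by (auto simp: test_fields_def)
    show "W x = 0" if "x \<notin> closure {x. Y x \<noteq> 0} \<union> closure {x. Z x \<noteq> 0}" for x
      using that test_field_outside[of x Y] test_field_outside[of x Z] by (simp add: W_def)
    show "norm (W x) \<le> 1" for x
    proof -
      have "norm (W x) \<le> \<phi> x * norm (Y x) + (1 - \<phi> x) * norm (Z x)"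
        unfolding W_def by (rule norm_triangle_le) (use \<phi>(2)[of x] in auto)
      also have "\<dots> \<le> \<phi> x * 1 + (1 - \<phi> x) * 1"
        using \<phi>(2)[of x] assms(2,3) by (intro add_mono mult_left_mono) (auto simp: test_fields_def)
      finally show ?thesis by simp
    qed
  qed
  let ?\<phi>' = "frechet_derivative \<phi> (at x)"
  have d\<phi>: "(\<phi> has_derivative ?\<phi>') (at x)" by (rule smooth_on_imp_has_derivative[OF \<phi>(1) UNIV_I])
  have d1: "((\<lambda>x. 1 - \<phi> x) has_derivative (\<lambda>v. - ?\<phi>' v)) (at x)"
    using has_derivative_diff[OF has_derivative_const d\<phi>, of 1] by simp
  have dW: "(W has_derivative (\<lambda>v. (\<phi> x *\<^sub>R frechet_derivative Y (at x) v + ?\<phi>' v *\<^sub>R Y x)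
      + ((1 - \<phi> x) *\<^sub>R frechet_derivative Z (at x) v + (- ?\<phi>' v) *\<^sub>R Z x))) (at x)"
    unfolding W_def
    by (intro has_derivative_add has_derivative_scaleR d\<phi> d1 smooth_on_imp_has_derivative[OF Y UNIV_I]
        smooth_on_imp_has_derivative[OF Z UNIV_I])
  have "divergence W x = \<phi> x * divergence Y x + (1 - \<phi> x) * divergence Z x
      + (\<Sum>b\<in>Basis. ?\<phi>' b * ((Y x - Z x) \<bullet> b))"
    unfolding divergence_eq[OF dW] unfolding divergence_def
    by (simp add: inner_add_left inner_diff_left algebra_simps sum.distrib sum_subtractf sum_distrib_left)
  then show "divergence W x = \<phi> x * divergence Y x + (1 - \<phi> x) * divergence Z x + ?\<phi>' (Y x - Z x)"
    using linear_sum_Basis[OF has_derivative_linear[OF d\<phi>], of "Y x - Z x"] by simp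
qed

text \<open>\<open>W\<close> agrees with \<open>Y\<close> inside the shell and with \<open>Z\<close>
  beyond it, so the error lives on the shell. The weight has slope at most 2 *
  \<open>step_slope\<close> / \<epsilon> and the fields differ by at most 2, which gives the 4; the
  term 2 S pays for exchanging the divergences and becomes negligible for thin shells.\<close>

lemma cut_by_ball:
  fixes M :: "'a::euclidean_space set"
  assumes M: "open M" and E: "E \<in> sets vol" and Y: "Y \<in> test_fields M" and Z: "Z \<in> test_fields M"
    and SY: "\<And>x. \<bar>divergence Y x\<bar> \<le> S" and SZ: "\<And>x. \<bar>divergence Z x\<bar> \<le> S"
    and \<epsilon>: "0 < \<epsilon>" "\<epsilon> \<le> r"
  obtains W where "W \<in> test_fields M"
    "(LINT x:E \<inter> ball 0 r|vol. divergence Y x) + (LINT x:E - ball 0 r|vol. divergence Z x)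
      \<le> (LINT x:E|vol. divergence W x)
        + (4 * step_slope / \<epsilon> + 2 * S) * measure vol (E \<inter> (ball 0 r - ball 0 (r - \<epsilon>)))"
proof -
  let ?A = "ball 0 r - ball 0 (r - \<epsilon>) :: 'a set" and ?B = "ball 0 r :: 'a set"
  obtain \<phi> :: "'a \<Rightarrow> real" where \<phi>: "smooth_on \<phi> UNIV" "\<And>x. 0 \<le> \<phi> x \<and> \<phi> x \<le> 1"
    and \<phi>0: "\<And>x. r \<le> norm x \<Longrightarrow> \<phi> x = 0" and \<phi>1: "\<And>x. norm x \<le> r - \<epsilon> \<Longrightarrow> \<phi> x = 1"
    and \<phi>': "\<And>x v. \<bar>frechet_derivative \<phi> (at x) v\<bar> \<le> 2 * step_slope / \<epsilon> * norm v * indicator ?A x"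
    using radial_cutoff[OF \<epsilon>] by blast
  define W where "W = (\<lambda>x. \<phi> x *\<^sub>R Y x + (1 - \<phi> x) *\<^sub>R Z x)"
  note W = test_field_blend[OF M Y Z \<phi>, folded W_def]
  have pt: "indicator (E \<inter> ?B) x * divergence Y x + indicator (E - ?B) x * divergence Z x
      \<le> indicator E x * divergence W x + (4 * step_slope / \<epsilon> + 2 * S) * indicator (E \<inter> ?A) x" for x
  proof (cases "x \<in> E")
    case True
    have d: "norm (Y x - Z x) \<le> 2"
      using norm_triangle_ineq4[of "Y x" "Z x"] Y Z by (auto simp: test_fields_def) (smt (verit))
    show ?thesis
    proof (cases "x \<in> ?A")
      \<comment> \<open>The shell lies inside the ball of radius r, so the left-hand side is the
        divergence of \<open>Y\<close> alone.\<close>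
      case A: True
      have "\<bar>frechet_derivative \<phi> (at x) (Y x - Z x)\<bar> \<le> 2 * step_slope / \<epsilon> * norm (Y x - Z x)"
        using \<phi>'[of x "Y x - Z x"] A by simp
      also have "\<dots> \<le> 2 * step_slope / \<epsilon> * 2" using d step_slope_pos \<epsilon> by (intro mult_left_mono) auto
      finally have 1: "\<bar>frechet_derivative \<phi> (at x) (Y x - Z x)\<bar> \<le> 4 * step_slope / \<epsilon>" by (simp add: mult.commute)
      have "\<bar>(1 - \<phi> x) * (divergence Y x - divergence Z x)\<bar> \<le> 1 * (2 * S)"
        unfolding abs_mult using \<phi>(2)[of x] SY[of x] SZ[of x] by (intro mult_mono) auto
      then have 2: "(1 - \<phi> x) * (divergence Y x - divergence Z x) \<le> 2 * S" by simp
      have "divergence Y x \<le> divergence W x + (4 * step_slope / \<epsilon> + 2 * S)"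
        unfolding W(2) using 1 2 by (simp add: algebra_simps abs_le_iff)
      then show ?thesis using True A by simp
    next
      case False
      have "frechet_derivative \<phi> (at x) (Y x - Z x) = 0" using \<phi>'[of x "Y x - Z x"] False by simp
      then have "divergence W x = (if x \<in> ?B then divergence Y x else divergence Z x)"
        unfolding W(2) using \<phi>0[of x] \<phi>1[of x] False by auto
      then show ?thesis using True False by simp
    qed
  qed simp
  have B: "E \<inter> ?B \<in> sets vol" "E - ?B \<in> sets vol" "E \<inter> ?A \<in> sets vol" using E by auto
  have "emeasure vol (E \<inter> ?A) < \<infinity>"
    unfolding infinity_ennreal_def
    by (rule emeasure_vol_bounded[OF B(3)]) (auto intro: bounded_subset[OF bounded_ball[of 0 r]])
  then have intA: "integrable vol (\<lambda>x. (4 * step_slope / \<epsilon> + 2 * S) * indicator (E \<inter> ?A) x)"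
    using B(3) by (intro integrable_mult_right integrable_real_indicator)
  note intd = test_field_divergence_facts(1)[OF M, THEN set_integrable_vol, unfolded set_integrable_def real_scaleR_def]
  have "(LINT x:E \<inter> ?B|vol. divergence Y x) + (LINT x:E - ?B|vol. divergence Z x)
      = (LINT x|vol. indicator (E \<inter> ?B) x * divergence Y x + indicator (E - ?B) x * divergence Z x)"
    unfolding set_lebesgue_integral_def real_scaleR_def
    by (intro Bochner_Integration.integral_add[symmetric] intd Y Z B)
  also have "\<dots> \<le> (LINT x|vol. indicator E x * divergence W x + (4 * step_slope / \<epsilon> + 2 * S) * indicator (E \<inter> ?A) x)"
    by (intro integral_mono pt Bochner_Integration.integrable_add intd intA Y Z W(1) B E)
  also have "\<dots> = (LINT x:E|vol. divergence W x) + (4 * step_slope / \<epsilon> + 2 * S) * measure vol (E \<inter> ?A)"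
    unfolding set_lebesgue_integral_def real_scaleR_def
    by (subst Bochner_Integration.integral_add) (use intd[OF W(1) E] intA B(3) in \<open>auto simp: infinity_ennreal_def\<close>)
  finally show ?thesis by (rule that[OF W(1)])
qed

text \<open>A test field is pulled back by the dilation, which keeps its support in the cone. The
  volume contributes t^d and differentiating Y(t x) contributes t to the other side, leaving
  t^(d-1).\<close>

lemma perimeter_scale_le:
  fixes M E :: "'a::euclidean_space set"
  assumes "open M" and cone: "\<And>x t. x \<in> M \<Longrightarrow> 0 < t \<Longrightarrow> t *\<^sub>R x \<in> M" and E: "E \<in> sets vol" and t: "0 < t"
  shows "perimeter M ((\<lambda>x. t *\<^sub>R x) ` E) \<le> ereal (t ^ (DIM('a) - 1)) * perimeter M E"
  unfolding perimeter_def[of M "(\<lambda>x. t *\<^sub>R x) ` E"]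
proof (rule SUP_least)
  fix Y assume Y: "Y \<in> test_fields M"
  note Y' = smooth_on_UNIV_test_field[OF assms(1) Y]
  define Z where "Z x = Y (t *\<^sub>R x)" for x
  have "smooth_on Z UNIV"
    using smooth_on_affine[of UNIV 0 t UNIV Y] Y' by (simp add: Z_def[abs_def])
  moreover have "compact ((*\<^sub>R) (1 / t) ` closure {x. Y x \<noteq> 0})"
    using Y by (intro compact_scaling) (auto simp: test_fields_def)
  moreover have "(*\<^sub>R) (1 / t) ` closure {x. Y x \<noteq> 0} \<subseteq> M"
    using Y t cone[of _ "1 / t"] by (auto simp: test_fields_def)
  moreover have "Z x = 0" if "x \<notin> (*\<^sub>R) (1 / t) ` closure {x. Y x \<noteq> 0}" for x
  proof -
    have "t *\<^sub>R x \<notin> closure {x. Y x \<noteq> 0}"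
    proof
      assume "t *\<^sub>R x \<in> closure {x. Y x \<noteq> 0}"
      then have "(1 / t) *\<^sub>R (t *\<^sub>R x) \<in> (*\<^sub>R) (1 / t) ` closure {x. Y x \<noteq> 0}" by (rule imageI)
      then show False using that t by simp
    qed
    then show ?thesis using test_field_outside[of "t *\<^sub>R x" Y] by (simp add: Z_def)
  qed
  ultimately have Z: "Z \<in> test_fields M"
    by (rule test_fieldI) (use Y in \<open>auto simp: test_fields_def Z_def\<close>)
  have dZ: "divergence Z x = t * divergence Y (t *\<^sub>R x)" for x
  proof -
    have "((\<lambda>x. t *\<^sub>R x) has_derivative (\<lambda>v. t *\<^sub>R v)) (at x)" by (auto intro!: derivative_eq_intros)
    note has_derivative_compose[OF this smooth_on_imp_has_derivative[OF Y' UNIV_I]]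
    moreover have "frechet_derivative Y (at (t *\<^sub>R x)) (t *\<^sub>R v) = t *\<^sub>R frechet_derivative Y (at (t *\<^sub>R x)) v" for v
      using linear_scale[OF has_derivative_linear[OF smooth_on_imp_has_derivative[OF Y' UNIV_I]]] by blast
    ultimately have "(Z has_derivative (\<lambda>v. t *\<^sub>R frechet_derivative Y (at (t *\<^sub>R x)) v)) (at x)"
      by (simp add: Z_def[abs_def])
    from divergence_eq[OF this] show ?thesis by (simp add: divergence_def sum_distrib_left)
  qed
  have mem: "t *\<^sub>R x \<in> (\<lambda>x. t *\<^sub>R x) ` E \<longleftrightarrow> x \<in> E" for x using t by (auto simp: image_iff)
  have meas: "(\<lambda>x. indicator ((\<lambda>x. t *\<^sub>R x) ` E) x * divergence Y x) \<in> borel_measurable vol"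
    using sets_vol_affine[OF E t, of 0] continuous_on_divergence[OF Y']
    by (intro borel_measurable_times borel_measurable_indicator borel_measurable_vol
        borel_measurable_continuous_onI) auto
  have "(LINT x:(\<lambda>x. t *\<^sub>R x) ` E|vol. divergence Y x)
      = t ^ DIM('a) * (LINT x|vol. indicator E x * divergence Y (t *\<^sub>R x))"
    unfolding set_lebesgue_integral_def real_scaleR_def
    using integral_vol_affine[OF meas t, of 0] mem by (simp add: indicator_def)
  also have "t ^ DIM('a) = t ^ (DIM('a) - 1) * t"
    using DIM_positive[where 'a='a] by (metis power_minus_mult)
  also have "\<dots> * (LINT x|vol. indicator E x * divergence Y (t *\<^sub>R x))
      = t ^ (DIM('a) - 1) * (LINT x:E|vol. divergence Z x)"
    by (simp add: set_lebesgue_integral_def dZ mult.left_commute mult.assoc)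
  finally have eq: "(LINT x:(\<lambda>x. t *\<^sub>R x) ` E|vol. divergence Y x) = t ^ (DIM('a) - 1) * (LINT x:E|vol. divergence Z x)" .
  have "ereal (LINT x:E|vol. divergence Z x) \<le> perimeter M E"
    unfolding perimeter_def by (rule SUP_upper[OF Z])
  then have "ereal (t ^ (DIM('a) - 1)) * ereal (LINT x:E|vol. divergence Z x) \<le> ereal (t ^ (DIM('a) - 1)) * perimeter M E"
    using t by (intro ereal_mult_left_mono) auto
  then show "ereal (LINT x:(\<lambda>x. t *\<^sub>R x) ` E|vol. divergence Y x) \<le> ereal (t ^ (DIM('a) - 1)) * perimeter M E"
    unfolding eq by simp
qed

lemma perimeter_nonneg: "0 \<le> perimeter M E"
proof -
  have "ereal (LINT x:E|vol. divergence (\<lambda>_. 0) x) \<le> perimeter M E"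
    unfolding perimeter_def by (rule SUP_upper[OF zero_in_test_fields])
  then show ?thesis by (simp add: set_lebesgue_integral_def zero_ereal_def)
qed

lemma perimeter_whole_space: "open M \<Longrightarrow> perimeter M M = 0"
  by (rule antisym[OF _ perimeter_nonneg])
    (auto simp: perimeter_def integral_divergence_eq_0 zero_ereal_def intro!: SUP_least)

text \<open>\<open>D\<close> bounds the volume of thin inner shells per unit of thickness and so
  stands for the area of the cut. As \<epsilon> tends to 0, the part of the error that depends on
  the chosen fields disappears and only the multiple of \<open>D\<close> remains.\<close>

lemma perimeter_cut:
  fixes M :: "'a::euclidean_space set"
  assumes M: "open M" and E: "E \<in> sets vol" and e: "0 < e" "e \<le> r" and D: "0 \<le> D"
    "\<And>\<epsilon>. 0 < \<epsilon> \<Longrightarrow> \<epsilon> < e \<Longrightarrow> measure vol (E \<inter> (ball 0 r - ball 0 (r - \<epsilon>))) \<le> D * \<epsilon>"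
  shows "perimeter M (E \<inter> ball 0 r) + perimeter M (E - ball 0 r)
    \<le> perimeter M E + ereal (4 * step_slope * D)"
proof (cases "perimeter M E = \<infinity>")
  case False
  then obtain p where p: "perimeter M E = ereal p"
    using perimeter_nonneg[of M E] by (cases "perimeter M E") auto
  let ?I = "\<lambda>Y. LINT x:E \<inter> ball 0 r|vol. divergence Y x" and ?J = "\<lambda>Z. LINT x:E - ball 0 r|vol. divergence Z x"
  have sum: "?I Y + ?J Z \<le> p + 4 * step_slope * D" if Y: "Y \<in> test_fields M" and Z: "Z \<in> test_fields M" for Y Z
  proof (rule field_le_epsilon)
    fix d :: real assume "0 < d"
    obtain BY where BY: "0 < BY" "\<And>x. \<bar>divergence Y x\<bar> \<le> BY"
      using test_field_divergence_facts(2)[OF M Y] by blast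
    obtain BZ where BZ: "0 < BZ" "\<And>x. \<bar>divergence Z x\<bar> \<le> BZ"
      using test_field_divergence_facts(2)[OF M Z] by blast
    define S where "S = BY + BZ"
    have S: "0 < S" "\<And>x. \<bar>divergence Y x\<bar> \<le> S" "\<And>x. \<bar>divergence Z x\<bar> \<le> S"
      using BY BZ by (auto simp: S_def intro: add_increasing add_increasing2 less_imp_le)
    \<comment> \<open>Makes \<open>2 * S * D * \<epsilon>\<close> at most d; the added 1 avoids
      division by 0 when D = 0.\<close>
    define \<epsilon> where "\<epsilon> = min (e / 2) (d / (2 * S * D + 1))"
    have pos: "0 < 2 * S * D + 1" using S(1) D(1) by (simp add: add_nonneg_pos)
    then have \<epsilon>: "0 < \<epsilon>" "\<epsilon> < e" "\<epsilon> \<le> d / (2 * S * D + 1)" "\<epsilon> \<le> r"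
      using e \<open>0 < d\<close> by (auto simp: \<epsilon>_def min_less_iff_disj)
    obtain W where W: "W \<in> test_fields M"
      "?I Y + ?J Z \<le> (LINT x:E|vol. divergence W x) + (4 * step_slope / \<epsilon> + 2 * S) * measure vol (E \<inter> (ball 0 r - ball 0 (r - \<epsilon>)))"
      by (rule cut_by_ball[OF M E Y Z S(2,3) \<epsilon>(1,4)])
    have "ereal (LINT x:E|vol. divergence W x) \<le> ereal p"
      unfolding p[symmetric] perimeter_def by (rule SUP_upper[OF W(1)])
    moreover have "(4 * step_slope / \<epsilon> + 2 * S) * measure vol (E \<inter> (ball 0 r - ball 0 (r - \<epsilon>))) \<le> (4 * step_slope / \<epsilon> + 2 * S) * (D * \<epsilon>)"
      using step_slope_pos S(1) \<epsilon> by (intro mult_left_mono D(2)) auto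
    moreover have "(4 * step_slope / \<epsilon> + 2 * S) * (D * \<epsilon>) = 4 * step_slope * D + 2 * S * D * \<epsilon>" using \<epsilon>(1) by (simp add: field_simps)
    moreover have "2 * S * D * \<epsilon> \<le> d"
    proof -
      have "2 * S * D * \<epsilon> \<le> (2 * S * D + 1) * \<epsilon>" using \<epsilon>(1) by (simp add: algebra_simps)
      also have "\<dots> \<le> d" using \<epsilon>(3) pos by (simp add: field_simps)
      finally show ?thesis .
    qed
    ultimately show "?I Y + ?J Z \<le> p + 4 * step_slope * D + d" using W(2) by simp
  qed
  \<comment> \<open>The suprema are taken one at a time. With \<open>Z\<close> fixed, the one over
    \<open>Y\<close> bounds the inner perimeter; \<open>Z\<close> = 0 shows that it is a real number
    q, which can then be moved to the other side before the supremum over \<open>Z\<close>.\<close>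
  have P1: "perimeter M (E \<inter> ball 0 r) \<le> ereal (p + 4 * step_slope * D - ?J Z)" if "Z \<in> test_fields M" for Z
    unfolding perimeter_def using sum that by (intro SUP_least) (simp add: le_diff_eq)
  from this[OF zero_in_test_fields] obtain q where q: "perimeter M (E \<inter> ball 0 r) = ereal q"
    using perimeter_nonneg[of M "E \<inter> ball 0 r"] by (cases "perimeter M (E \<inter> ball 0 r)") auto
  have "?J Z \<le> p + 4 * step_slope * D - q" if "Z \<in> test_fields M" for Z
    using P1[OF that] unfolding q by simp
  then have "perimeter M (E - ball 0 r) \<le> ereal (p + 4 * step_slope * D - q)"
    unfolding perimeter_def by (intro SUP_least) simp
  then show ?thesis unfolding p q by (cases "perimeter M (E - ball 0 r)") auto
qed simp

lemma power_diff_le: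
  fixes a b :: real
  assumes "0 \<le> a" "a \<le> b"
  shows "b ^ n - a ^ n \<le> real n * b ^ (n - 1) * (b - a)"
proof (induction n)
  case (Suc n)
  have "b ^ Suc n - a ^ Suc n = b * (b ^ n - a ^ n) + a ^ n * (b - a)" by (simp add: algebra_simps)
  also have "\<dots> \<le> b * (real n * b ^ (n - 1) * (b - a)) + b ^ n * (b - a)"
    using Suc assms by (intro add_mono mult_left_mono mult_right_mono power_mono) auto
  also have "\<dots> = real (Suc n) * b ^ (Suc n - 1) * (b - a)"
    by (cases n) (auto simp: algebra_simps)
  finally show ?case .
qed simp

text \<open>Cutting \<open>M\<close> itself: its perimeter is 0, and the shells are no larger than
  full spherical shells, whose volume is at most \<beta> d r^(d-1) per unit of thickness.\<close>

lemma perimeter_Int_ball_finite: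
  fixes M :: "'a::euclidean_space set"
  assumes "open M" "0 < r"
  shows "perimeter M (M \<inter> ball 0 r) < \<infinity>"
proof -
  define \<beta> where "\<beta> = measure vol (ball (0::'a) 1)"
  define D where "D = \<beta> * (real DIM('a) * r ^ (DIM('a) - 1))"
  have fin: "emeasure vol A \<noteq> \<infinity>" if "A \<in> sets vol" "bounded A" for A :: "'a set"
    using emeasure_vol_bounded[OF that] by simp
  have ball: "measure vol (ball (0::'a) s) = s ^ DIM('a) * \<beta>" if "0 < s" for s
    unfolding measure_def \<beta>_def emeasure_vol_ball[OF that] using that by (simp add: enn2real_mult)
  have "measure vol (M \<inter> (ball 0 r - ball 0 (r - \<epsilon>))) \<le> D * \<epsilon>" if "0 < \<epsilon>" "\<epsilon> < r" for \<epsilon>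
  proof -
    have "measure vol (M \<inter> (ball 0 r - ball 0 (r - \<epsilon>))) \<le> measure vol (ball (0::'a) r - ball 0 (r - \<epsilon>))"
    proof (rule measure_mono_fmeasurable)
      have "ball (0::'a) r - ball 0 (r - \<epsilon>) \<in> sets vol" by simp
      then show "ball (0::'a) r - ball 0 (r - \<epsilon>) \<in> fmeasurable vol"
        by (intro fmeasurableI emeasure_vol_bounded[folded infinity_ennreal_def])
          (auto intro: bounded_subset[OF bounded_ball[of 0 r]])
    qed (use assms in auto)
    also have "\<dots> = measure vol (ball (0::'a) r) - measure vol (ball (0::'a) (r - \<epsilon>))"
      using fin[of "ball 0 r"] that by (intro measure_Diff) auto
    also have "\<dots> = \<beta> * (r ^ DIM('a) - (r - \<epsilon>) ^ DIM('a))"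
      using that by (simp add: ball algebra_simps)
    also have "\<dots> \<le> \<beta> * (real DIM('a) * r ^ (DIM('a) - 1) * (r - (r - \<epsilon>)))"
      using that by (intro mult_left_mono power_diff_le) (auto simp: \<beta>_def)
    finally show ?thesis by (simp add: D_def mult.assoc)
  qed
  then have "perimeter M (M \<inter> ball 0 r) + perimeter M (M - ball 0 r) \<le> perimeter M M + ereal (4 * step_slope * D)"
    using assms by (intro perimeter_cut[of M M r r D]) (auto simp: D_def \<beta>_def)
  then show ?thesis
    using perimeter_nonneg[of M "M - ball 0 r"] unfolding perimeter_whole_space[OF assms(1)]
    by (cases "perimeter M (M \<inter> ball 0 r)"; cases "perimeter M (M - ball 0 r)") auto
qed

text \<open>A bump is pushed along a ray of the cone to infinity. If \<open>\<Omega>\<close> has no perimeter, its integral over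
  \<open>\<Omega>\<close> does not change on the way; but it tends to \<open>0\<close> because \<open>\<Omega>\<close> has finite volume.\<close>

lemma emeasure_eq_0_of_perimeter_eq_0:
  fixes M :: "'a::euclidean_space set"
  assumes "open M" and cone: "\<And>x t. x \<in> M \<Longrightarrow> 0 < t \<Longrightarrow> t *\<^sub>R x \<in> M" and "0 \<notin> M"
    and \<Omega>: "\<Omega> \<subseteq> M" "\<Omega> \<in> sets vol" "emeasure vol \<Omega> < \<infinity>" and per: "perimeter M \<Omega> \<le> 0"
  shows "emeasure vol \<Omega> = 0"
proof -
  have loc: "\<exists>\<delta>>0. emeasure vol (\<Omega> \<inter> ball p \<delta>) = 0" if pM: "p \<in> M" for p
  proof -
    have p0: "p \<noteq> 0" using pM assms(3) by auto
    obtain \<rho> where \<rho>: "0 < \<rho>" "ball p \<rho> \<subseteq> M" by (rule openE[OF assms(1) pM])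
    \<comment> \<open>A radial bump, equal to 1 up to radius \<rho>/2, where the argument is at
      least 1, and equal to 0 once the squared norm is at least \<rho>^2/2. The radius 4/5 \<rho>
      suffices as (4/5)^2 > 1/2, and being below \<rho> it leaves room inside the ball.\<close>
    define \<psi> where "\<psi> z = smooth_step (2 + (- (4 / \<rho>\<^sup>2)) *\<^sub>R (z \<bullet> z))" for z :: 'a
    have "smooth_on (\<lambda>z::'a. 2 + (- (4 / \<rho>\<^sup>2)) *\<^sub>R (z \<bullet> z)) UNIV"
      by (intro smooth_on_add smooth_on_scaleR smooth_on_norm_square) auto
    from smooth_on_compose_real[OF _ _ smooth_on_smooth_step this]
    have smooth: "smooth_on \<psi> UNIV" unfolding \<psi>_def[abs_def] by simp
    have \<psi>01: "0 \<le> \<psi> z" "\<psi> z \<le> 1" for z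
      by (auto simp: \<psi>_def smooth_step_nonneg smooth_step_le_1)
    have \<psi>1: "\<psi> z = 1" if "norm z < \<rho> / 2" for z
    proof -
      have "(norm z)\<^sup>2 \<le> (\<rho> / 2)\<^sup>2" using that by (intro power_mono) auto
      then have "4 / \<rho>\<^sup>2 * (z \<bullet> z) \<le> 1" using \<rho>(1) by (simp add: power2_norm_eq_inner field_simps power_divide)
      then show ?thesis by (simp add: \<psi>_def)
    qed
    have \<psi>0: "\<psi> z = 0" if "4 / 5 * \<rho> < norm z" for z
    proof -
      have "(4 / 5 * \<rho>)\<^sup>2 \<le> (norm z)\<^sup>2" using that \<rho>(1) by (intro power_mono) auto
      then have "\<rho>\<^sup>2 * (16 / 25) \<le> z \<bullet> z" by (simp add: power2_norm_eq_inner power_mult_distrib power_divide)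
      then have "\<rho>\<^sup>2 * 2 \<le> 4 * (z \<bullet> z)" using zero_le_power2[of \<rho>] by linarith
      then have "2 \<le> 4 / \<rho>\<^sup>2 * (z \<bullet> z)" using \<rho>(1) by (simp add: field_simps)
      then show ?thesis by (simp add: \<psi>_def)
    qed
    define f where "f t x = \<psi> (- ((1 + t) *\<^sub>R p) + 1 *\<^sub>R x)" for t x
    have f_smooth: "smooth_on (f t) UNIV" for t
      unfolding f_def[abs_def] by (rule smooth_on_affine[of _ _ _ UNIV]) (auto simp: smooth)
    let ?K = "\<lambda>t. cball ((1 + t) *\<^sub>R p) (4 / 5 * \<rho>)"
    have f0: "f t x = 0" if "x \<notin> ?K t" for t x
      using that unfolding f_def by (intro \<psi>0) (simp add: dist_norm norm_minus_commute)
    \<comment> \<open>Dividing by 1 + t \<ge> 1 brings the centre back to p and does not enlarge the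
      ball, so it lands in the ball of radius \<rho> around p; the cone property leads back.\<close>
    have KM: "?K t \<subseteq> M" if "0 \<le> t" for t
    proof
      fix x assume x: "x \<in> ?K t"
      have "norm (x - (1 + t) *\<^sub>R p) < \<rho>" using x \<rho>(1) by (simp add: dist_norm norm_minus_commute)
      also have "\<rho> \<le> (1 + t) * \<rho>" using that \<rho>(1) by (simp add: algebra_simps)
      finally have "norm (x - (1 + t) *\<^sub>R p) / (1 + t) < \<rho>" using that by (simp add: field_simps)
      moreover have "p - (1 / (1 + t)) *\<^sub>R x = (- (1 / (1 + t))) *\<^sub>R (x - (1 + t) *\<^sub>R p)"
        using that by (simp add: scaleR_diff_right)
      ultimately have "norm (p - (1 / (1 + t)) *\<^sub>R x) < \<rho>" using that by simp
      then have "(1 / (1 + t)) *\<^sub>R x \<in> M" using \<rho>(2) by (auto simp: dist_norm)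
      from cone[OF this, of "1 + t"] show "x \<in> M" using that by simp
    qed
    have flat: "(LINT x:\<Omega>|vol. frechet_derivative (f t) (at x) p) = 0" if t: "0 \<le> t" for t
    proof -
      \<comment> \<open>The bump times a constant vector along p is a test field. Vanishing
        perimeter bounds its flux by 0, and using both signs of c forces equality.\<close>
      have le: "c * (LINT x:\<Omega>|vol. frechet_derivative (f t) (at x) p) \<le> 0" if c: "norm (c *\<^sub>R p) \<le> 1" for c
      proof -
        define Y where "Y x = f t x *\<^sub>R (c *\<^sub>R p)" for x
        have "Y \<in> test_fields M"
        proof (rule test_fieldI[OF _ compact_cball KM[OF t]])
          show "smooth_on Y UNIV" unfolding Y_def[abs_def] by (intro smooth_on_scaleR f_smooth) auto
          show "Y x = 0" if "x \<notin> ?K t" for x using f0[OF that] by (simp add: Y_def)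
          show "norm (Y x) \<le> 1" for x
          proof -
            have "norm (Y x) = \<bar>f t x\<bar> * norm (c *\<^sub>R p)" by (simp add: Y_def abs_mult)
            also have "\<dots> \<le> 1 * 1" using \<psi>01 c by (intro mult_mono) (auto simp: f_def)
            finally show ?thesis by simp
          qed
        qed
        then have "ereal (LINT x:\<Omega>|vol. divergence Y x) \<le> perimeter M \<Omega>"
          unfolding perimeter_def by (rule SUP_upper)
        also note per
        finally have "ereal (LINT x:\<Omega>|vol. divergence Y x) \<le> 0" .
        moreover have "divergence Y x = c * frechet_derivative (f t) (at x) p" for x
        proof -
          note d = smooth_on_imp_has_derivative[OF f_smooth UNIV_I, of t x]
          have "(Y has_derivative (\<lambda>v. frechet_derivative (f t) (at x) v *\<^sub>R (c *\<^sub>R p))) (at x)"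
            unfolding Y_def[abs_def] by (rule has_derivative_scaleR_left[OF d])
          from divergence_eq[OF this]
          have "divergence Y x = (\<Sum>b\<in>Basis. frechet_derivative (f t) (at x) b * ((c *\<^sub>R p) \<bullet> b))" by (simp add: mult.assoc)
          also have "\<dots> = frechet_derivative (f t) (at x) (c *\<^sub>R p)"
            by (rule linear_sum_Basis[OF has_derivative_linear[OF d]])
          also have "\<dots> = c * frechet_derivative (f t) (at x) p"
            using linear_scale[OF has_derivative_linear[OF d], of c p] by simp
          finally show ?thesis .
        qed
        ultimately show ?thesis by (simp add: zero_ereal_def)
      qed
      have "norm ((1 / norm p) *\<^sub>R p) \<le> 1" "norm ((- (1 / norm p)) *\<^sub>R p) \<le> 1" using p0 by auto
      from le[OF this(1)] le[OF this(2)] show ?thesis using p0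
        by (simp add: mult_le_0_iff divide_le_0_iff zero_le_divide_iff zero_le_mult_iff)
    qed
    define G where "G t = (LINT x:\<Omega>|vol. f t x)" for t
    have G': "(G has_real_derivative 0) (at t)" if t: "0 \<le> t" for t
    proof -
      note d = smooth_on_imp_has_derivative[OF f_smooth UNIV_I, of t]
      \<comment> \<open>Moving the bump forward by h p means evaluating it at x - h p, hence the
        direction -p.\<close>
      have "frechet_derivative (f t) (at x) (- p) = - frechet_derivative (f t) (at x) p" for x
        by (rule linear_neg[OF has_derivative_linear[OF d]])
      then have "(LINT x:\<Omega>|vol. frechet_derivative (f t) (at x) (- p)) = 0"
        using flat[OF t] by (simp add: set_lebesgue_integral_def)
      moreover have "(\<lambda>h. LINT x:\<Omega>|vol. f t (x + h *\<^sub>R (- p))) = (\<lambda>h. G (h + t))"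
        by (simp add: G_def f_def algebra_simps)
      moreover have "((\<lambda>h. LINT x:\<Omega>|vol. f t (x + h *\<^sub>R (- p))) has_real_derivative
          (LINT x:\<Omega>|vol. frechet_derivative (f t) (at x) (- p))) (at 0)"
        by (rule has_derivative_integral_translate[where K = "?K t", OF f_smooth compact_cball _ \<Omega>(2)])
          (rule f0)
      ultimately have "((\<lambda>h. G (h + t)) has_real_derivative 0) (at 0)" by (simp only:)
      then show ?thesis using DERIV_shift[of G 0 0 t] by simp
    qed
    have const: "G t = G 0" if "0 < t" for t
    proof (rule DERIV_isconst_end[OF that])
      show "continuous_on {0..t} G"
        using G' by (intro continuous_at_imp_continuous_on ballI DERIV_isCont) auto
    qed (use G' in auto)
    have "(\<lambda>n. G (real n)) \<longlonglongrightarrow> (LINT x:\<Omega>|vol. (0::real))"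
      unfolding G_def set_lebesgue_integral_def
    proof (rule integral_dominated_convergence[where w = "indicator \<Omega>"])
      have "f t \<in> borel_measurable vol" for t
        using f_smooth[of t] Ck_on_imp_continuous_on[of 0 "f t" UNIV] unfolding smooth_on_def
        by (intro borel_measurable_vol borel_measurable_continuous_onI) blast
      then show "(\<lambda>x. indicator \<Omega> x *\<^sub>R f (real n) x) \<in> borel_measurable vol" for n
        using \<Omega>(2) by (intro borel_measurable_scaleR borel_measurable_indicator) auto
      show "integrable vol (indicator \<Omega> :: 'a \<Rightarrow> real)" using \<Omega> by (intro integrable_real_indicator)
      show "AE x in vol. norm (indicator \<Omega> x *\<^sub>R f (real n) x) \<le> indicator \<Omega> x" for n
        using \<psi>01 by (auto simp: indicator_def f_def)
      show "AE x in vol. (\<lambda>n. indicator \<Omega> x *\<^sub>R f (real n) x) \<longlonglongrightarrow> indicator \<Omega> x *\<^sub>R 0"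
      proof (rule AE_I2)
        fix x :: 'a
        obtain N :: nat where N: "(norm x + \<rho>) / norm p < real N" using reals_Archimedean2 by blast
        have "f (real n) x = 0" if "N \<le> n" for n
        proof (rule f0)
          have "norm x + \<rho> < real N * norm p" using N p0 by (simp add: field_simps)
          also have "\<dots> \<le> (1 + real n) * norm p" using that by (intro mult_right_mono) auto
          also have "\<dots> = norm ((1 + real n) *\<^sub>R p)" by simp
          also have "\<dots> \<le> norm ((1 + real n) *\<^sub>R p - x) + norm x" using norm_triangle_sub[of "(1 + real n) *\<^sub>R p" x] by simp
          finally show "x \<notin> ?K (real n)" using \<rho>(1) by (simp add: dist_norm)
        qed
        then have "eventually (\<lambda>n. indicator \<Omega> x *\<^sub>R f (real n) x = indicator \<Omega> x *\<^sub>R 0) sequentially"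
          by (auto simp: eventually_sequentially intro!: exI[of _ N])
        then show "(\<lambda>n. indicator \<Omega> x *\<^sub>R f (real n) x) \<longlonglongrightarrow> indicator \<Omega> x *\<^sub>R 0"
          by (rule tendsto_eventually)
      qed
    qed (use \<Omega>(2) in auto)
    moreover have "(\<lambda>n. G (real n)) = (\<lambda>_. G 0)"
    proof
      show "G (real n) = G 0" for n using const[of "real n"] by (cases n) auto
    qed
    ultimately have G0: "G 0 = 0" using LIMSEQ_unique[OF tendsto_const] by (fastforce simp: set_lebesgue_integral_def)
    have B: "\<Omega> \<inter> ball p (\<rho> / 2) \<in> sets vol" using \<Omega>(2) by auto
    have le\<Omega>: "emeasure vol (\<Omega> \<inter> ball p (\<rho> / 2)) \<le> emeasure vol \<Omega>"
      using \<Omega>(2) by (intro emeasure_mono) auto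
    have contf: "continuous_on UNIV (f 0)" using f_smooth[of 0] Ck_on_imp_continuous_on unfolding smooth_on_def by blast
    \<comment> \<open>In its initial position the bump dominates the indicator of the ball of radius
      \<rho>/2, so its vanishing integral makes \<Omega> null there.\<close>
    have "measure vol (\<Omega> \<inter> ball p (\<rho> / 2)) = (LINT x|vol. indicator (\<Omega> \<inter> ball p (\<rho> / 2)) x)"
      by simp
    also have "\<dots> \<le> (LINT x|vol. indicator \<Omega> x *\<^sub>R f 0 x)"
    proof (rule integral_mono)
      show "integrable vol (indicator (\<Omega> \<inter> ball p (\<rho> / 2)) :: 'a \<Rightarrow> real)"
        using B le\<Omega> \<Omega>(3) by (intro integrable_real_indicator) auto
      show "integrable vol (\<lambda>x. indicator \<Omega> x *\<^sub>R f 0 x)"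
        by (intro integrable_mult_indicator \<Omega>(2)
            integrable_vol_compact_support[where K = "?K 0", OF contf compact_cball]) (rule f0)
      show "indicator (\<Omega> \<inter> ball p (\<rho> / 2)) x \<le> indicator \<Omega> x *\<^sub>R f 0 x" for x
        using \<psi>01[of "x - p"] \<psi>1[of "x - p"] by (auto simp: indicator_def f_def dist_norm norm_minus_commute)
    qed
    also have "\<dots> = 0" using G0 by (simp add: G_def set_lebesgue_integral_def)
    finally have "measure vol (\<Omega> \<inter> ball p (\<rho> / 2)) = 0" by (simp add: measure_le_0_iff)
    moreover have "emeasure vol (\<Omega> \<inter> ball p (\<rho> / 2)) < \<infinity>" using le\<Omega> \<Omega>(3) by auto
    ultimately have "emeasure vol (\<Omega> \<inter> ball p (\<rho> / 2)) = 0" by (simp add: emeasure_eq_ennreal_measure)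
    then show ?thesis using \<rho>(1) by (intro exI[of _ "\<rho> / 2"]) auto
  qed
  then obtain \<delta> where \<delta>: "\<And>p. p \<in> M \<Longrightarrow> 0 < \<delta> p" "\<And>p. p \<in> M \<Longrightarrow> emeasure vol (\<Omega> \<inter> ball p (\<delta> p)) = 0"
    by metis
  \<comment> \<open>Countably many of these balls already cover \<open>M\<close>, so that the null
    pieces can be united.\<close>
  obtain \<B> where \<B>: "\<B> \<subseteq> (\<lambda>p. ball p (\<delta> p)) ` M" "countable \<B>" "\<Union>\<B> = \<Union>((\<lambda>p. ball p (\<delta> p)) ` M)"
    by (rule Lindelof[of "(\<lambda>p. ball p (\<delta> p)) ` M"]) auto
  have "(\<Union>B\<in>\<B>. \<Omega> \<inter> B) \<in> null_sets vol"
  proof (rule null_sets_UN'[OF \<B>(2)])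
    fix B assume "B \<in> \<B>"
    then obtain p where "p \<in> M" "B = ball p (\<delta> p)" using \<B>(1) by auto
    then show "\<Omega> \<inter> B \<in> null_sets vol" using \<delta>(2) \<Omega>(2) by (intro null_setsI) auto
  qed
  moreover have "(\<Union>B\<in>\<B>. \<Omega> \<inter> B) = \<Omega>"
  proof -
    have "\<Omega> \<subseteq> \<Union>\<B>" unfolding \<B>(3) using \<Omega>(1) \<delta>(1) by force
    then show ?thesis by auto
  qed
  ultimately show ?thesis by auto
qed

section \<open>Isoperimetric regions in cones\<close>

lemma cone_over_scaleR: "x \<in> cone_over C \<Longrightarrow> 0 < t \<Longrightarrow> t *\<^sub>R x \<in> cone_over C"
  unfolding cone_over_def by (force intro: mult_pos_pos)

lemma zero_notin_cone_over: "C \<subseteq> sphere 0 1 \<Longrightarrow> 0 \<notin> cone_over C"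
  by (auto simp: cone_over_def)

text \<open>The cone is the preimage of an open set under the radial projection to the sphere, which
  is continuous away from the apex.\<close>

lemma open_cone_over:
  fixes C :: "'a::euclidean_space set"
  assumes "openin (top_of_set (sphere 0 1)) C"
  shows "open (cone_over C)"
proof -
  obtain T where T: "open T" "C = sphere 0 1 \<inter> T" using assms by (auto simp: openin_open)
  have "cone_over C = {x. x \<noteq> 0} \<inter> (\<lambda>x. (1 / norm x) *\<^sub>R x) -` T"
  proof (intro equalityI subsetI)
    fix x assume "x \<in> cone_over C"
    then show "x \<in> {x. x \<noteq> 0} \<inter> (\<lambda>x. (1 / norm x) *\<^sub>R x) -` T"
      using T(2) by (auto simp: cone_over_def)
  next
    fix x assume x: "x \<in> {x. x \<noteq> 0} \<inter> (\<lambda>x. (1 / norm x) *\<^sub>R x) -` T"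
    then have "x = norm x *\<^sub>R ((1 / norm x) *\<^sub>R x)" "(1 / norm x) *\<^sub>R x \<in> C" using T(2) by auto
    then show "x \<in> cone_over C" unfolding cone_over_def using x by (metis (mono_tags, lifting) IntD1 mem_Collect_eq zero_less_norm_iff)
  qed
  moreover have "open ({x::'a. x \<noteq> 0} \<inter> (\<lambda>x. (1 / norm x) *\<^sub>R x) -` T)"
    by (intro continuous_open_preimage T continuous_intros) (auto simp: open_Collect_neq continuous_on_const continuous_on_id)
  ultimately show ?thesis by simp
qed

text \<open>Excluding the apex ensures that dilating a point of \<open>M\<close> really moves it to
  infinity, as the positivity of the perimeter requires.\<close>

locale cone_isoperimetric =
  fixes M \<Omega> :: "'a::euclidean_space set" and V :: real
  assumes open_M: "open M"
    and cone: "x \<in> M \<Longrightarrow> 0 < t \<Longrightarrow> t *\<^sub>R x \<in> M"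
    and zero_notin: "0 \<notin> M"
    and iso: "isoperimetric_region M V \<Omega>"
begin

lemma V_pos: "0 < V"
  and \<Omega>_subset: "\<Omega> \<subseteq> M"
  and \<Omega>_sets: "\<Omega> \<in> sets vol"
  and \<Omega>_vol: "emeasure vol \<Omega> = ennreal V"
  and minimal: "E \<subseteq> M \<Longrightarrow> E \<in> sets vol \<Longrightarrow> emeasure vol E = ennreal V \<Longrightarrow> perimeter M \<Omega> \<le> perimeter M E"
  using iso by (auto simp: isoperimetric_region_def sets_of_volume_def intro: INF_lower)

lemma vol_UNIV: "emeasure (vol :: 'a measure) UNIV \<noteq> 0"
  using \<Omega>_vol V_pos emeasure_mono[of \<Omega> UNIV "vol :: 'a measure"] by auto

lemma perimeter_pos: "0 < perimeter M \<Omega>"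
proof (rule ccontr)
  assume "\<not> 0 < perimeter M \<Omega>"
  then have "emeasure vol \<Omega> = 0"
    by (intro emeasure_eq_0_of_perimeter_eq_0[OF open_M cone zero_notin \<Omega>_subset \<Omega>_sets])
      (auto simp: \<Omega>_vol not_less)
  then show False using \<Omega>_vol V_pos by simp
qed

text \<open>Scaling turns minimality at volume \<open>V\<close> into an isoperimetric inequality for all volumes.\<close>

lemma perimeter_ge:
  assumes E: "E \<subseteq> M" "E \<in> sets vol" "emeasure vol E = ennreal (u ^ DIM('a) * V)" and u: "0 < u"
  shows "ereal (u ^ (DIM('a) - 1)) * perimeter M \<Omega> \<le> perimeter M E"
proof -
  let ?E = "(\<lambda>x. (1 / u) *\<^sub>R x) ` E"
  have sub: "?E \<subseteq> M" using E(1) cone u by auto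
  have sets: "?E \<in> sets vol" using sets_vol_affine[OF E(2), of "1 / u" 0] u by simp
  have "emeasure vol ?E = ennreal ((1 / u) ^ DIM('a)) * ennreal (u ^ DIM('a) * V)"
    using emeasure_vol_affine[OF E(2), of "1 / u" 0] u E(3) by simp
  also have "\<dots> = ennreal ((1 / u) ^ DIM('a) * (u ^ DIM('a) * V))" using u V_pos by (intro ennreal_mult[symmetric]) auto
  also have "(1 / u) ^ DIM('a) * (u ^ DIM('a) * V) = V" using u by (simp add: power_one_over)
  finally have "perimeter M \<Omega> \<le> perimeter M ?E" by (rule minimal[OF sub sets])
  also have "\<dots> \<le> ereal ((1 / u) ^ (DIM('a) - 1)) * perimeter M E"
    using u by (intro perimeter_scale_le open_M cone E(2)) auto
  finally have "ereal (u ^ (DIM('a) - 1)) * perimeter M \<Omega> \<le> ereal (u ^ (DIM('a) - 1)) * (ereal ((1 / u) ^ (DIM('a) - 1)) * perimeter M E)"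
    using u by (intro ereal_mult_left_mono) auto
  also have "\<dots> = perimeter M E"
    using u by (simp add: mult.assoc[symmetric] power_one_over one_ereal_def[symmetric])
  finally show ?thesis .
qed

text \<open>The competitor is \<open>M\<close> intersected with the ball of the right radius. Its
  volume is m r^d, where m is the volume for r = 1, so r is the d-th root of V/m.\<close>

lemma perimeter_finite: "perimeter M \<Omega> < \<infinity>"
proof -
  let ?B = "\<lambda>r. M \<inter> ball 0 r"
  have M: "M \<in> sets vol" using open_M by simp
  have scale: "?B r = (\<lambda>x. 0 + r *\<^sub>R x) ` ?B 1" if r: "0 < r" for r
  proof (intro equalityI subsetI)
    fix x assume "x \<in> ?B r"
    then have "(1 / r) *\<^sub>R x \<in> ?B 1" "x = 0 + r *\<^sub>R ((1 / r) *\<^sub>R x)"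
      using cone[of x "1 / r"] r by auto
    then show "x \<in> (\<lambda>x. 0 + r *\<^sub>R x) ` ?B 1" by (rule rev_image_eqI)
  qed (use cone r in auto)
  have B: "emeasure vol (?B r) = ennreal (r ^ DIM('a)) * emeasure vol (?B 1)" if "0 < r" for r
    unfolding scale[OF that] using M that by (intro emeasure_vol_affine) auto
  have "emeasure vol (?B 1) < top"
    using M by (intro emeasure_vol_bounded) (auto intro: bounded_subset[OF bounded_ball[of 0 1]])
  then obtain m where m: "emeasure vol (?B 1) = ennreal m" "0 \<le> m"
    by (cases "emeasure vol (?B 1)") auto
  \<comment> \<open>Otherwise scaling would make all such intersections null; they exhaust
    \<open>M\<close>, which contains \<Omega>.\<close>
  have "m \<noteq> 0"
  proof
    assume "m = 0"
    have "emeasure vol (\<Union>n. ?B (real (Suc n))) = 0"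
    proof (rule emeasure_UN_eq_0)
      show "emeasure vol (?B (real (Suc n))) = 0" for n
        by (subst B) (simp_all only: m \<open>m = 0\<close>, simp_all)
    qed (use M in auto)
    moreover have "\<Omega> \<subseteq> (\<Union>n. ?B (real (Suc n)))"
    proof
      fix x assume "x \<in> \<Omega>"
      obtain n where "norm x < real n" using reals_Archimedean2 by blast
      then have "x \<in> ?B (real (Suc n))" using \<open>x \<in> \<Omega>\<close> \<Omega>_subset by auto
      then show "x \<in> (\<Union>n. ?B (real (Suc n)))" by blast
    qed
    then have "emeasure vol \<Omega> \<le> emeasure vol (\<Union>n. ?B (real (Suc n)))"
      using M by (intro emeasure_mono) auto
    ultimately show False using \<Omega>_vol V_pos by simp
  qed
  then have "0 < m" using m(2) by simp
  define r where "r = root DIM('a) (V / m)"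
  have r: "0 < r" "r ^ DIM('a) = V / m" using V_pos \<open>0 < m\<close> by (auto simp: r_def real_root_gt_zero real_root_pow_pos)
  have "emeasure vol (?B r) = ennreal V"
    unfolding B[OF r(1)] m(1) r(2) using \<open>0 < m\<close> V_pos by (simp flip: ennreal_mult)
  then have "perimeter M \<Omega> \<le> perimeter M (?B r)" using M by (intro minimal) auto
  also have "\<dots> < \<infinity>" by (rule perimeter_Int_ball_finite[OF open_M r(1)])
  finally show ?thesis .
qed

text \<open>The dilation factor that turns volume V into the volume of \<Omega> outside the ball.
  This is the \<open>u\<close> of \<open>perimeter_ge\<close>, and the quantity whose decay is
  linear.\<close>

definition tail :: "real \<Rightarrow> real" where
  "tail r = root DIM('a) (measure vol (\<Omega> - ball 0 r) / V)"

lemma tail_nonneg: "0 \<le> tail r"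
  using V_pos by (simp add: tail_def)

lemma tail_vol: "measure vol (\<Omega> - ball 0 r) = tail r ^ DIM('a) * V"
  using V_pos by (simp add: tail_def real_root_pow_pos2)

lemma fmeasurable_subset: "A \<in> sets vol \<Longrightarrow> A \<subseteq> \<Omega> \<Longrightarrow> A \<in> fmeasurable vol"
  by (rule fmeasurableI2[OF fmeasurableI[OF \<Omega>_sets]]) (simp_all add: \<Omega>_vol)

lemma vol_eq_measure: "A \<in> sets vol \<Longrightarrow> A \<subseteq> \<Omega> \<Longrightarrow> emeasure vol A = ennreal (measure vol A)"
  by (rule emeasure_eq_measure2[OF fmeasurable_subset])

lemma vol_finite: "A \<in> sets vol \<Longrightarrow> A \<subseteq> \<Omega> \<Longrightarrow> emeasure vol A \<noteq> \<infinity>"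
  by (subst vol_eq_measure) auto

lemma tail_antimono: "s \<le> r \<Longrightarrow> tail r \<le> tail s"
  unfolding tail_def
  using V_pos \<Omega>_sets by (intro real_root_le_mono divide_right_mono measure_mono_fmeasurable fmeasurable_subset) auto

lemma tail_le_half: "\<exists>r>0. tail r \<le> 1/2"
proof -
  have "(\<lambda>n. measure vol (\<Omega> - ball 0 (real n))) \<longlonglongrightarrow> measure vol (\<Inter>n. \<Omega> - ball 0 (real n))"
  proof (rule Lim_measure_decseq)
    show "emeasure vol (\<Omega> - ball 0 (real i)) \<noteq> \<infinity>" for i
      using \<Omega>_sets by (intro vol_finite) auto
  qed (use \<Omega>_sets in \<open>auto simp: decseq_def\<close>)
  also have "(\<Inter>n. \<Omega> - ball 0 (real n)) = {}"
  proof -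
    have "\<exists>n. norm x < real n" for x :: 'a using reals_Archimedean2 by blast
    then show ?thesis by auto
  qed
  finally have "(\<lambda>n. measure vol (\<Omega> - ball 0 (real n))) \<longlonglongrightarrow> 0" by simp
  moreover have "0 < V / 2 ^ DIM('a)" using V_pos by simp
  ultimately have "eventually (\<lambda>n. measure vol (\<Omega> - ball 0 (real n)) < V / 2 ^ DIM('a)) sequentially"
    by (rule order_tendstoD)
  then have "eventually (\<lambda>n. 0 < n \<and> measure vol (\<Omega> - ball 0 (real n)) < V / 2 ^ DIM('a)) sequentially"
    using eventually_gt_at_top[of 0] by eventually_elim simp
  then obtain n where n: "0 < n" "measure vol (\<Omega> - ball 0 (real n)) < V / 2 ^ DIM('a)"
    using eventually_happens'[OF sequentially_bot] by blast
  have "tail (real n) \<le> root DIM('a) ((1/2) ^ DIM('a))"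
    unfolding tail_def using n(2) V_pos by (intro real_root_le_mono) (auto simp: field_simps power_one_over)
  also have "\<dots> = 1/2" by (simp add: real_root_power_cancel)
  finally show ?thesis using n(1) by (intro exI[of _ "real n"]) auto
qed

text \<open>Solved for in \<open>tail_decay\<close>: V d comes from differentiating V u^d, the power
  of 2 from bounding nearby tails by 2 u, and 16 is the 4 of the cutting estimate times another 4,
  so that a cut costs only a quarter of u^(d-1) P(\<Omega>).\<close>

definition rate :: real where
  "rate = real_of_ereal (perimeter M \<Omega>) / (16 * step_slope * V * real DIM('a) * 2 ^ (DIM('a) - 1))"

lemma rate_pos: "0 < rate"
proof -
  have "0 < real_of_ereal (perimeter M \<Omega>)"
    using perimeter_pos perimeter_finite by (cases "perimeter M \<Omega>") auto
  then show ?thesis using step_slope_pos V_pos by (simp add: rate_def)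
qed

text \<open>Cutting \<open>\<Omega>\<close> along the sphere of radius \<open>r\<close> and estimating both pieces by the isoperimetric inequality
  shows that the area of the cut, hence the decay of the tail at \<open>r\<close>, is bounded below.\<close>

lemma tail_decay:
  assumes a: "0 < a" "a < r" and half: "tail r \<le> 1/2" and pos: "0 < tail r"
  shows "\<exists>s. a \<le> s \<and> s < r \<and> tail r + rate * (r - s) \<le> tail s"
proof (rule ccontr)
  assume "\<not> ?thesis"
  then have slow: "tail s < tail r + rate * (r - s)" if "a \<le> s" "s < r" for s
    using that by force
  obtain p where p: "perimeter M \<Omega> = ereal p" "0 < p"
    using perimeter_pos perimeter_finite by (cases "perimeter M \<Omega>") auto
  let ?u = "tail r"
  define D where "D = V * real DIM('a) * (2 * ?u) ^ (DIM('a) - 1) * rate"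
  \<comment> \<open>For \<epsilon> below the first bound the radius r - \<epsilon> stays where decay
    is assumed slow; the second keeps \<open>?u + rate * \<epsilon>\<close> below twice
    \<open>?u\<close>.\<close>
  define e where "e = min (r - a) (?u / rate)"
  have e: "0 < e" "e \<le> r" using a pos rate_pos by (auto simp: e_def)
  have cut: "measure vol (\<Omega> \<inter> (ball 0 r - ball 0 (r - \<epsilon>))) \<le> D * \<epsilon>" if \<epsilon>: "0 < \<epsilon>" "\<epsilon> < e" for \<epsilon>
  proof -
    have \<epsilon>': "\<epsilon> < r - a" "rate * \<epsilon> \<le> ?u" using \<epsilon> rate_pos by (auto simp: e_def field_simps)
    have le: "tail (r - \<epsilon>) \<le> ?u + rate * \<epsilon>" using slow[of "r - \<epsilon>"] \<epsilon> \<epsilon>' by simp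
    have shell: "\<Omega> \<inter> (ball 0 r - ball 0 (r - \<epsilon>)) = (\<Omega> - ball 0 (r - \<epsilon>)) - (\<Omega> - ball 0 r)" by auto
    have "measure vol (\<Omega> \<inter> (ball 0 r - ball 0 (r - \<epsilon>))) = measure vol (\<Omega> - ball 0 (r - \<epsilon>)) - measure vol (\<Omega> - ball 0 r)"
      unfolding shell by (rule measure_Diff[OF vol_finite]) (use \<Omega>_sets \<epsilon>(1) in auto)
    also have "\<dots> = V * (tail (r - \<epsilon>) ^ DIM('a) - ?u ^ DIM('a))" by (simp add: tail_vol algebra_simps)
    also have "\<dots> \<le> V * ((?u + rate * \<epsilon>) ^ DIM('a) - ?u ^ DIM('a))"
      using V_pos le tail_nonneg by (intro mult_left_mono diff_right_mono power_mono) auto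
    also have "\<dots> \<le> V * (real DIM('a) * (?u + rate * \<epsilon>) ^ (DIM('a) - 1) * ((?u + rate * \<epsilon>) - ?u))"
      using V_pos pos rate_pos \<epsilon>(1) by (intro mult_left_mono power_diff_le) auto
    also have "\<dots> \<le> V * (real DIM('a) * (2 * ?u) ^ (DIM('a) - 1) * ((?u + rate * \<epsilon>) - ?u))"
      using V_pos pos rate_pos \<epsilon>(1) \<epsilon>'(2) by (intro mult_left_mono mult_right_mono power_mono) auto
    finally show ?thesis by (simp add: D_def algebra_simps)
  qed
  have "0 \<le> D" using V_pos pos rate_pos by (simp add: D_def)
  note per = perimeter_cut[OF open_M \<Omega>_sets e this cut]
  have out: "ereal (?u ^ (DIM('a) - 1)) * perimeter M \<Omega> \<le> perimeter M (\<Omega> - ball 0 r)"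
  proof (intro perimeter_ge pos)
    show "emeasure vol (\<Omega> - ball 0 r) = ennreal (?u ^ DIM('a) * V)"
      using \<Omega>_sets by (subst vol_eq_measure) (auto simp: tail_vol)
  qed (use \<Omega>_subset \<Omega>_sets in auto)
  \<comment> \<open>The dilation factor for the inner piece. \<open>perimeter_ge\<close> requires it
    to be positive, which is why \<open>?u ^ DIM('a)\<close> is bounded by 1/2 first.\<close>
  define w where "w = root DIM('a) (1 - ?u ^ DIM('a))"
  have "?u ^ DIM('a) \<le> ?u ^ 1" using half pos by (intro power_decreasing) (auto simp: Suc_leI)
  then have "?u ^ DIM('a) \<le> 1/2" using half by simp
  then have w: "0 < w" "w \<le> 1" "w ^ DIM('a) = 1 - ?u ^ DIM('a)"
    using pos by (auto simp: w_def real_root_gt_zero real_root_pow_pos2)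
  have inner: "\<Omega> \<inter> ball 0 r = \<Omega> - (\<Omega> - ball 0 r)" by auto
  have "measure vol (\<Omega> \<inter> ball 0 r) = measure vol \<Omega> - measure vol (\<Omega> - ball 0 r)"
    unfolding inner by (rule measure_Diff[OF vol_finite]) (use \<Omega>_sets in auto)
  moreover have "measure vol \<Omega> = V" using \<Omega>_vol V_pos by (simp add: measure_def)
  ultimately have in_vol: "measure vol (\<Omega> \<inter> ball 0 r) = w ^ DIM('a) * V" by (simp add: tail_vol w(3) algebra_simps)
  have inside: "ereal (w ^ (DIM('a) - 1)) * perimeter M \<Omega> \<le> perimeter M (\<Omega> \<inter> ball 0 r)"
  proof (intro perimeter_ge w)
    show "emeasure vol (\<Omega> \<inter> ball 0 r) = ennreal (w ^ DIM('a) * V)"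
      using \<Omega>_sets by (subst vol_eq_measure) (auto simp: in_vol)
  qed (use \<Omega>_subset \<Omega>_sets in auto)
  have "ereal (w ^ (DIM('a) - 1)) * ereal p + ereal (?u ^ (DIM('a) - 1)) * ereal p \<le> ereal p + ereal (4 * step_slope * D)"
    using order_trans[OF add_mono[OF inside out] per] by (simp only: p)
  then have "w ^ (DIM('a) - 1) * p + ?u ^ (DIM('a) - 1) * p \<le> p + 4 * step_slope * D" by simp
  moreover have "w ^ DIM('a) \<le> w ^ (DIM('a) - 1)" using w by (intro power_decreasing) auto
  then have "(1 - ?u ^ DIM('a)) * p \<le> w ^ (DIM('a) - 1) * p" using p(2) w(3) by (intro mult_right_mono) auto
  \<comment> \<open>The outer piece adds u^(d-1) P(\<Omega>), while the lower bound for the inner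
    one falls short of P(\<Omega>) by at most u^d P(\<Omega>). As u \<le> 1/2, at least half of the
    gain survives, against a cost of only a quarter of it.\<close>
  ultimately have "(?u ^ (DIM('a) - 1) - ?u ^ DIM('a)) * p \<le> 4 * step_slope * D" by (simp add: algebra_simps)
  moreover have "?u ^ DIM('a) = ?u ^ (DIM('a) - 1) * ?u" by (metis DIM_positive power_minus_mult)
  moreover have "4 * step_slope * D = ?u ^ (DIM('a) - 1) * (p / 4)"
    using step_slope_pos V_pos by (simp add: D_def rate_def p power_mult_distrib)
  ultimately have "?u ^ (DIM('a) - 1) * ((1 - ?u) * p) \<le> ?u ^ (DIM('a) - 1) * (p / 4)" by (simp add: algebra_simps)
  then have "(1 - ?u) * p \<le> p / 4" using pos by simp
  moreover have "1/2 * p \<le> (1 - ?u) * p" using half p(2) by (intro mult_right_mono) auto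
  ultimately show False using p(2) by simp
qed

text \<open>\<open>S\<close> collects the radii from which the linear bound up to b holds. Its
  infimum belongs to it because the tail is decreasing, so no continuity is involved; and if it
  exceeded a, \<open>tail_decay\<close> would produce a smaller member.\<close>

lemma tail_linear_decay:
  assumes a: "0 < a" "a \<le> b" and half: "tail a \<le> 1/2" and pos: "0 < tail b"
  shows "tail b + rate * (b - a) \<le> tail a"
proof -
  define S where "S = {s \<in> {a..b}. tail b + rate * (b - s) \<le> tail s}"
  define m where "m = Inf S"
  have "b \<in> S" using a by (simp add: S_def)
  have bdd: "bdd_below S" by (rule bdd_belowI[of _ a]) (simp add: S_def)
  have "a \<le> m"
    unfolding m_def
  proof (rule cInf_greatest)
    show "S \<noteq> {}" using \<open>b \<in> S\<close> by blast
    show "a \<le> s" if "s \<in> S" for s using that by (simp add: S_def)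
  qed
  moreover have "m \<le> b" unfolding m_def by (rule cInf_lower[OF \<open>b \<in> S\<close> bdd])
  ultimately have m: "a \<le> m" "m \<le> b" .
  have mS: "tail b + rate * (b - m) \<le> tail m"
  proof (rule ccontr)
    assume *: "\<not> ?thesis"
    \<comment> \<open>The amount by which the bound fails at m, divided by the slope. A member of
      \<open>S\<close> within \<eta> to the right of m has too large a tail, and the tail at m is at
      least as large.\<close>
    define \<eta> where "\<eta> = (tail b + rate * (b - m) - tail m) / rate"
    have "0 < \<eta>" using * rate_pos by (simp add: \<eta>_def)
    then obtain s where s: "s \<in> S" "s < m + \<eta>"
      using cInf_lessD[of S "m + \<eta>"] \<open>b \<in> S\<close> unfolding m_def by auto
    have "m \<le> s" unfolding m_def using s(1) bdd by (rule cInf_lower)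
    then have "tail b + rate * (b - s) \<le> tail m" using s(1) tail_antimono[of m s] by (simp add: S_def)
    moreover have "rate * (s - m) < rate * \<eta>" using s(2) rate_pos by simp
    moreover have "rate * \<eta> = tail b + rate * (b - m) - tail m" using rate_pos by (simp add: \<eta>_def)
    ultimately show False by (simp add: algebra_simps)
  qed
  have "m = a"
  proof (rule ccontr)
    assume "m \<noteq> a"
    then have "a < m" using m by simp
    have "0 < tail m" using tail_antimono[of m b] m pos by linarith
    moreover have "tail m \<le> 1/2" using tail_antimono[of a m] m half by linarith
    ultimately obtain s where s: "a \<le> s" "s < m" "tail m + rate * (m - s) \<le> tail s"
      using tail_decay[OF a(1) \<open>a < m\<close>] by blast
    then have "s \<in> S" using mS m by (auto simp: S_def algebra_simps)
    then show False using cInf_lower[OF _ bdd, of s] s(2) by (simp add: m_def)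
  qed
  then show ?thesis using mS by simp
qed

lemma tail_vanishes: "\<exists>r>0. emeasure vol (\<Omega> - ball 0 r) = 0"
proof -
  obtain a where a: "0 < a" "tail a \<le> 1/2" using tail_le_half by blast
  \<comment> \<open>Over this length the linear decay amounts to 1, more than the tail has left at
    a.\<close>
  define b where "b = a + 1 / rate"
  have "a \<le> b" "0 < b" using rate_pos a(1) by (auto simp: b_def add_pos_pos)
  have "tail b = 0"
  proof (rule ccontr)
    assume "tail b \<noteq> 0"
    then have "0 < tail b" using tail_nonneg[of b] by simp
    from tail_linear_decay[OF a(1) \<open>a \<le> b\<close> a(2) this]
    have "tail b + 1 \<le> 1/2" using a(2) rate_pos by (simp add: b_def)
    then show False using tail_nonneg[of b] by simp
  qed
  then have "measure vol (\<Omega> - ball 0 b) = 0" by (simp add: tail_vol)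
  then have "emeasure vol (\<Omega> - ball 0 b) = 0" using \<Omega>_sets by (subst vol_eq_measure) auto
  then show ?thesis using \<open>0 < b\<close> by blast
qed

text \<open>A point of \<Omega> beyond the radius \<open>R\<close> has a ball around it in
  \<open>M\<close> and still beyond \<open>R\<close>. Either \<Omega> fills this ball, or
  connectedness puts a boundary point of \<Omega> into it; in both cases \<Omega> would have
  positive volume beyond \<open>R\<close>.\<close>

lemma bounded_if_normalized:
  assumes "normalized_in M \<Omega>"
  shows "bounded \<Omega>"
proof -
  obtain R where R: "0 < R" "emeasure vol (\<Omega> - ball 0 R) = 0" using tail_vanishes by blast
  have null: "emeasure vol A = 0" if "A \<subseteq> \<Omega> - ball 0 R" for A
  proof -
    have "\<Omega> - ball 0 R \<in> sets vol" using \<Omega>_sets by auto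
    from emeasure_mono[OF that this] show ?thesis using R(2) by simp
  qed
  have "norm x \<le> R" if x: "x \<in> \<Omega>" for x
  proof (rule ccontr)
    assume "\<not> norm x \<le> R"
    then have x': "x \<in> M \<inter> - cball 0 R" using x \<Omega>_subset by auto
    have "open (M \<inter> - cball 0 R)" using open_M by (intro open_Int open_Compl) auto
    then obtain \<rho> where \<rho>: "0 < \<rho>" "ball x \<rho> \<subseteq> M \<inter> - cball 0 R" using x' by (rule openE)
    show False
    proof (cases "ball x \<rho> \<subseteq> \<Omega>")
      case True
      then have "emeasure vol (ball x \<rho>) = 0" using \<rho>(2) by (intro null) fastforce
      then show False using emeasure_vol_ball_pos[OF vol_UNIV \<rho>(1), of x] by simp
    next
      case False
      then have "ball x \<rho> \<inter> frontier \<Omega> \<noteq> {}"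
        using x \<rho>(1) by (intro connected_Int_frontier) (auto simp: disjoint_iff intro!: exI[of _ x])
      then obtain q where q: "q \<in> ball x \<rho>" "q \<in> frontier \<Omega>" by auto
      \<comment> \<open>Because \<open>M\<close> is open, the frontier relative to \<open>M\<close>
        is the part of the ordinary frontier lying in \<open>M\<close>.\<close>
      then have "q \<in> top_of_set M frontier_of \<Omega>"
        using open_M \<rho>(2) by (auto simp: frontier_of_subtopology_open)
      moreover obtain \<sigma> where \<sigma>: "0 < \<sigma>" "ball q \<sigma> \<subseteq> ball x \<rho>" using q(1) by (rule openE[OF open_ball])
      ultimately have "0 < emeasure vol (\<Omega> \<inter> (ball q \<sigma> \<inter> M))"
        using assms by (auto simp: normalized_in_def)
      moreover have "\<Omega> \<inter> (ball q \<sigma> \<inter> M) \<subseteq> \<Omega> - ball 0 R" using \<sigma>(2) \<rho>(2) by fastforce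
      ultimately show False using null by force
    qed
  qed
  then show ?thesis by (auto simp: bounded_iff)
qed

end

theorem proposition3p7:
  fixes C M \<Omega> :: "'a::euclidean_space set" and V :: real
  assumes "openin (top_of_set (sphere 0 1)) C"
    and "connected C"
    and "smooth_boundary_in_sphere C"
    and "M = cone_over C"
    and "isoperimetric_region M V \<Omega>"
    and "normalized_in M \<Omega>"
  shows "bounded \<Omega>"
proof -
  have "C \<subseteq> sphere 0 1" using openin_subset[OF assms(1)] by simp
  from zero_notin_cone_over[OF this] interpret cone_isoperimetric M \<Omega> V
    using assms(1,4,5) open_cone_over cone_over_scaleR by unfold_locales auto
  show ?thesis by (rule bounded_if_normalized[OF assms(6)])
qed

end
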